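(* Let $\mathcal{X}$ be finite, $P^\pi\in\mathbb{R}^{\mathcal{X}\times\mathcal{X}}$ row-stochastic, $\gamma\in[0,1)$, $K\in\mathbb{N}$, and fix $\Phi_0\in\mathbb{R}^{\mathcal{X}\times K}$. For $M\in\mathbb{N}$ let $r^1,\dots,r^M\in\mathbb{R}^{\mathcal{X}}$ be i.i.d. random reward functions from a fixed mean-zero distribution with covariance matrix $\Sigma$, and let $\mathbf{w}^1,\dots,\mathbf{w}^M\in\mathbb{R}^K$ be independent of them with i.i.d. $\mathcal{N}(0,\frac1M)$ entries, held fixed throughout training. Let $\Phi^M_t$, $\Phi^M_0=\Phi_0$, follow $$\partial_t\Phi^M_t=\sum_{m=1}^M\big(r^m+\gamma P^\pi\Phi^M_t\mathbf{w}^m-\Phi^M_t\mathbf{w}^m\big)(\mathbf{w}^m)^\top.$$ Then $$\lim_{M\to\infty}\sum_{m=1}^Mr^m(\mathbf{w}^m)^\top\overset{D}{=}Z_\Sigma,$$ where $Z_\Sigma\in\mathbb{R}^{\mathcal{X}\times K}$ is mean-zero Gaussian with independent columns each distributed as $\mathcal{N}(0,\Sigma)$, and $$\lim_{M\to\infty}\Phi^M_t\overset{D}{=}\exp(-t(I-\gamma P^\pi))\big(\Phi_0-(I-\gamma P^\pi)^{-1}Z_\Sigma\big)+(I-\gamma P^\pi)^{-1}Z_\Sigma.$$ Consequently each column of $\Phi_\infty=\lim_{t\to\infty}\lim_{M\to\infty}\Phi^M_t$ has covariance $\Psi\Sigma\Psi^\top$, where $\Psi=(I-\gamma P^\pi)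^{-1}$.
   Context: This models a representation $\Phi$ shared by $M$ linear heads each trained by continuous-time temporal-difference dynamics to predict the value of a randomly drawn cumulant (reward) $r^m$ under policy $\pi$, with transition matrix $P^\pi$. $\overset{D}{=}$ denotes equality in distribution of the limit; $\exp$ is the matrix exponential. *)

theory Defs
  imports "HOL-Analysis.Analysis" "HOL-Probability.Probability"
begin

primrec mpow :: "real^'n^'n \<Rightarrow> nat \<Rightarrow> real^'n^'n" where
  "mpow A 0 = mat 1"
| "mpow A (Suc n) = A ** mpow A n"

definition mexp :: "real^'n^'n \<Rightarrow> real^'n^'n" where
  "mexp A = (\<Sum>n. (1 / fact n) *\<^sub>R mpow A n)"

definition outer :: "real^'x \<Rightarrow> real^'k \<Rightarrow> real^'k^'x" where
  "outer u v = (\<chi> i j. u $ i * v $ j)"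

definition row_stochastic :: "real^'x^'x \<Rightarrow> bool" where
  "row_stochastic P \<longleftrightarrow> (\<forall>i j. 0 \<le> P $ i $ j) \<and> (\<forall>i. (\<Sum>j\<in>UNIV. P $ i $ j) = 1)"

definition conv_distr :: "('i \<Rightarrow> 'a::topological_space measure) \<Rightarrow> 'a measure \<Rightarrow> 'i filter \<Rightarrow> bool" where
  "conv_distr Ls L F \<longleftrightarrow>
     (\<forall>f :: 'a \<Rightarrow> real. continuous_on UNIV f \<longrightarrow> bounded (range f) \<longrightarrow>
        ((\<lambda>i. integral\<^sup>L (Ls i) f) \<longlongrightarrow> integral\<^sup>L L f) F)"

text \<open>Law of a mean-zero Gaussian random matrix Z in R^(X x K) whose columns are
  independent, each N(0, Sigma); defined through the characteristic function
  E exp(i <Theta, Z>) = exp(-1/2 sum_k Theta_k^T Sigma Theta_k).\<close>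
definition gaussian_matrix_law :: "real^'x^'x \<Rightarrow> (real^'k^'x) measure \<Rightarrow> bool" where
  "gaussian_matrix_law \<Sigma> Q \<longleftrightarrow> prob_space Q \<and> sets Q = sets borel \<and>
     (\<forall>\<Theta> :: real^'k^'x. (\<integral>z. cis (\<Theta> \<bullet> z) \<partial>Q) =
        complex_of_real (exp (- (\<Sum>k\<in>UNIV. column k \<Theta> \<bullet> (\<Sigma> *v column k \<Theta>)) / 2)))"

definition weight_law :: "nat \<Rightarrow> (real^'k) measure" where
  "weight_law M = density lborel
     (\<lambda>w. \<Prod>k\<in>UNIV. ennreal (normal_density 0 (1 / sqrt (real M)) (w $ k)))"

definition sample_law :: "(real^'x) measure \<Rightarrow> nat \<Rightarrow> ((nat \<Rightarrow> real^'x) \<times> (nat \<Rightarrow> real^'k)) measure" where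
  "sample_law R M = (PiM {..<M} (\<lambda>_. R)) \<Otimes>\<^sub>M (PiM {..<M} (\<lambda>_. weight_law M))"

definition cov_entry :: "(real^'x) measure \<Rightarrow> 'x \<Rightarrow> 'x \<Rightarrow> real" where
  "cov_entry L i j = (\<integral>v. (v $ i - (\<integral>u. u $ i \<partial>L)) * (v $ j - (\<integral>u. u $ j \<partial>L)) \<partial>L)"

end

theory Submission
  imports Defs
begin

text \<open>The joint law of $S_M = \sum_m r^m (w^m)^\top$ and $W_M = \sum_m w^m (w^m)^\top$ converges to the
  law of $(Z_\Sigma, I)$. Writing $w = g/\sqrt M$ with $g$ standard Gaussian, the characteristic
  function of $(S_M, W_M)$ is the $M$-th power of
  $E \exp(i a/\sqrt M + i b/M) = 1 + (-E a^2/2 + i E b)/M + o(1/M)$, where $a$ is linear and $b$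
  quadratic in $g$. Since $\Phi_t$ solves the affine equation $\Phi' = S_M - (I - \gamma P)\Phi W_M$,
  it is a continuous function of $(S_M, W_M)$, and the continuous mapping theorem gives its limit,
  which is the explicit solution for $W = I$.\<close>

section \<open>Gaussian measure on a Euclidean space\<close>

text \<open>The claims treat S_M and \<Phi>_t separately, but \<Phi>_t depends nonlinearly on W_M,
  and W_M is built from the same weights as S_M. Only the joint law can be pushed through the flow,
  and the first claim is then a projection of it. Using a fixed g puts a single sample on the same
  probability space for every M, so dominated convergence in M applies with second moments of the
  rewards only. The contribution a / sqrt M would diverge after multiplication by M; it drops out
  because E a = 0, g being centred for each fixed reward. Neither \<Phi> nor the law of Z_\<Sigma>
  is constructed. \<Phi> is known through its equation, one sample at a time, and is identified by
  uniqueness of solutions. The law of Z_\<Sigma> is known through its characteristic function, so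
  its covariances are extracted from one-dimensional projections. The limit in t is taken on the
  space of Z_\<Sigma>, where convergence is pointwise.\<close>

definition std_gaussian :: "'a::euclidean_space measure" where
  "std_gaussian = density lborel (\<lambda>x. ennreal (\<Prod>b\<in>Basis. std_normal_density (x \<bullet> b)))"

lemma sets_std_gaussian [simp, measurable_cong]: "sets std_gaussian = sets borel"
  and space_std_gaussian [simp]: "space std_gaussian = UNIV"
  by (simp_all add: std_gaussian_def)

lemma prob_space_std_gaussian: "prob_space (std_gaussian :: 'a::euclidean_space measure)"
proof
  have "(\<integral>\<^sup>+x. ennreal (std_normal_density x) \<partial>lborel) = 1"
    using prob_space.emeasure_space_1[OF prob_space_normal_density[of 1 0]]
    by (simp add: emeasure_density)
  then have "(\<integral>\<^sup>+x. (\<Prod>b\<in>Basis. ennreal (std_normal_density (x \<bullet> b))) \<partial>(lborel :: 'a measure)) = 1"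
    by (subst nn_integral_lborel_prod) auto
  then show "emeasure (std_gaussian :: 'a measure) (space std_gaussian) = 1"
    by (simp add: std_gaussian_def emeasure_density prod_ennreal)
qed

text \<open>Fubini in coordinates: \<open>lborel\<close> is the image of a finite product of
  one-dimensional Lebesgue measures, so once the density is distributed over the factors the
  integral splits.\<close>

lemma integral_std_gaussian_prod:
  fixes h :: "'a::euclidean_space \<Rightarrow> real \<Rightarrow> complex"
  assumes h: "\<And>b. b \<in> Basis \<Longrightarrow> integrable std_normal_distribution (h b)"
  shows "(\<integral>x. (\<Prod>b\<in>Basis. h b (x \<bullet> b)) \<partial>std_gaussian) =
         (\<Prod>b\<in>Basis. integral\<^sup>L std_normal_distribution (h b))"
proof -
  interpret product_sigma_finite "\<lambda>_::'a. lborel :: real measure"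
    by standard
  have [measurable]: "h b \<in> borel_measurable borel" if "b \<in> Basis" for b
    using borel_measurable_integrable[OF h[OF that]] by simp
  have int: "integrable lborel (\<lambda>x. std_normal_density x *\<^sub>R h b x)" if "b \<in> Basis" for b
    using h[OF that] that by (subst (asm) integrable_density) auto
  have "(\<integral>x. (\<Prod>b\<in>Basis. h b (x \<bullet> b)) \<partial>std_gaussian) =
      (\<integral>x. (\<Prod>b\<in>Basis. std_normal_density (x \<bullet> b) *\<^sub>R h b (x \<bullet> b)) \<partial>lborel)"
    unfolding std_gaussian_def
    by (subst integral_density) (auto simp: prod_nonneg scaleR_conv_of_real prod.distrib)
  also have "\<dots> = (\<integral>f. (\<Prod>b\<in>Basis. std_normal_density (f b) *\<^sub>R h b (f b)) \<partial>(\<Pi>\<^sub>M b\<in>Basis. lborel))"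
    by (subst lborel_eq, subst integral_distr) (auto intro!: Bochner_Integration.integral_cong)
  also have "\<dots> = (\<Prod>b\<in>Basis. \<integral>x. std_normal_density x *\<^sub>R h b x \<partial>lborel)"
    by (rule product_integral_prod) (auto intro: int)
  also have "\<dots> = (\<Prod>b\<in>Basis. integral\<^sup>L std_normal_distribution (h b))"
    by (intro prod.cong refl) (subst integral_density, auto)
  finally show ?thesis .
qed

lemma char_std_gaussian:
  fixes \<theta> :: "'a::euclidean_space"
  shows "(\<integral>x. cis (\<theta> \<bullet> x) \<partial>std_gaussian) = complex_of_real (exp (- (\<theta> \<bullet> \<theta>) / 2))"
proof -
  interpret real_distribution std_normal_distribution by (rule real_dist_normal_dist)
  have "(\<integral>x. cis (\<theta> \<bullet> x) \<partial>std_gaussian)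
      = (\<integral>x. (\<Prod>b\<in>Basis. cis ((\<theta> \<bullet> b) * (x \<bullet> b))) \<partial>(std_gaussian :: 'a measure))"
  proof (intro Bochner_Integration.integral_cong refl)
    fix x :: 'a
    have "cis (\<theta> \<bullet> x) = cis (\<Sum>b\<in>Basis. (\<theta> \<bullet> b) * (x \<bullet> b))"
      by (subst euclidean_inner) simp
    also have "\<dots> = (\<Prod>b\<in>Basis. cis ((\<theta> \<bullet> b) * (x \<bullet> b)))"
      by (simp add: cis_conv_exp sum_distrib_left exp_sum)
    finally show "cis (\<theta> \<bullet> x) = (\<Prod>b\<in>Basis. cis ((\<theta> \<bullet> b) * (x \<bullet> b)))" .
  qed
  also have "\<dots> = (\<Prod>b\<in>Basis. \<integral>x. cis ((\<theta> \<bullet> b) * x) \<partial>std_normal_distribution)"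
    by (rule integral_std_gaussian_prod)
       (auto intro!: integrable_const_bound[where B=1] simp: cis_conv_exp)
  also have "\<dots> = (\<Prod>b\<in>Basis. complex_of_real (exp (- ((\<theta> \<bullet> b)^2) / 2)))"
    using char_std_normal_distribution by (simp add: char_def fun_eq_iff cis_conv_exp)
  also have "\<dots> = complex_of_real (exp (\<Sum>b\<in>Basis. - ((\<theta> \<bullet> b)^2) / 2))"
    by (simp add: exp_sum)
  also have "(\<Sum>b\<in>Basis. - ((\<theta> \<bullet> b)^2) / 2) = - (\<theta> \<bullet> \<theta>) / 2"
    unfolding euclidean_inner[of \<theta> \<theta>] by (simp add: sum_negf sum_divide_distrib power2_eq_square)
  finally show ?thesis .
qed

text \<open>One-dimensional Levy uniqueness identifies the law of
  \<open>\<theta> \<bullet> x\<close> with that of \<open>sqrt q\<close> times a standard normal,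
  whose moments are known. Only the characteristic function along the line through
  \<open>\<theta>\<close> enters, so the same lemma serves the explicit density of
  \<open>std_gaussian\<close> and a law given by its characteristic function alone.\<close>

lemma gaussian_char_moments:
  fixes N :: "'a::euclidean_space measure" and q :: real and \<theta> :: 'a
  assumes N: "prob_space N" "sets N = sets borel"
    and char: "\<And>s. (\<integral>x. cis (s * (\<theta> \<bullet> x)) \<partial>N) = complex_of_real (exp (- (s\<^sup>2 * q) / 2))"
    and q: "0 \<le> q"
  shows "integrable N (\<lambda>x. \<theta> \<bullet> x)" "(\<integral>x. \<theta> \<bullet> x \<partial>N) = 0"
    "integrable N (\<lambda>x. (\<theta> \<bullet> x)\<^sup>2)" "(\<integral>x. (\<theta> \<bullet> x)\<^sup>2 \<partial>N) = q"
proof -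
  interpret prob_space N by fact
  note N(2)[measurable_cong]
  interpret S: real_distribution std_normal_distribution by (rule real_dist_normal_dist)
  have "distr N borel (\<lambda>x. \<theta> \<bullet> x) = distr std_normal_distribution borel (\<lambda>x. sqrt q * x)"
  proof (rule Levy_uniqueness)
    show "char (distr N borel (\<lambda>x. \<theta> \<bullet> x)) = char (distr std_normal_distribution borel (\<lambda>x. sqrt q * x))"
    proof
      fix s
      have "char (distr N borel (\<lambda>x. \<theta> \<bullet> x)) s = complex_of_real (exp (- (s\<^sup>2 * q) / 2))"
        unfolding char[symmetric] by (simp add: char_def integral_distr cis_conv_exp)
      also have "\<dots> = char std_normal_distribution (s * sqrt q)"
        using q by (simp add: char_std_normal_distribution power_mult_distrib)
      also have "\<dots> = char (distr std_normal_distribution borel (\<lambda>x. sqrt q * x)) s"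
        by (simp add: char_def integral_distr mult.assoc)
      finally show "char (distr N borel (\<lambda>x. \<theta> \<bullet> x)) s
        = char (distr std_normal_distribution borel (\<lambda>x. sqrt q * x)) s" .
    qed
  qed auto
  then have eq: "distr N borel (\<lambda>x. \<theta> \<bullet> x) = distr std_normal_distribution borel (\<lambda>x. sqrt q * x)" .
  \<comment> \<open>Transfer rule for functions of the projection, applied below to the identity and
    to the square.\<close>
  have tr_int: "integrable N (\<lambda>x. f (\<theta> \<bullet> x)) \<longleftrightarrow> integrable std_normal_distribution (\<lambda>x. f (sqrt q * x))"
    and tr: "(\<integral>x. f (\<theta> \<bullet> x) \<partial>N) = (\<integral>x. f (sqrt q * x) \<partial>std_normal_distribution)"
    if [measurable]: "f \<in> borel_measurable borel" for f :: "real \<Rightarrow> real"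
  proof -
    have "integrable N (\<lambda>x. f (\<theta> \<bullet> x)) \<longleftrightarrow> integrable (distr N borel (\<lambda>x. \<theta> \<bullet> x)) f"
      by (subst integrable_distr_eq) auto
    also have "\<dots> \<longleftrightarrow> integrable std_normal_distribution (\<lambda>x. f (sqrt q * x))"
      unfolding eq by (subst integrable_distr_eq) auto
    finally show "integrable N (\<lambda>x. f (\<theta> \<bullet> x)) \<longleftrightarrow> integrable std_normal_distribution (\<lambda>x. f (sqrt q * x))" .
    have "(\<integral>x. f (\<theta> \<bullet> x) \<partial>N) = integral\<^sup>L (distr N borel (\<lambda>x. \<theta> \<bullet> x)) f"
      by (subst integral_distr) auto
    also have "\<dots> = (\<integral>x. f (sqrt q * x) \<partial>std_normal_distribution)"
      unfolding eq by (subst integral_distr) auto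
    finally show "(\<integral>x. f (\<theta> \<bullet> x) \<partial>N) = (\<integral>x. f (sqrt q * x) \<partial>std_normal_distribution)" .
  qed
  have m1: "integrable std_normal_distribution (\<lambda>x. x)"
    using integrable_std_normal_distribution_moment[of 1] by simp
  have e1: "(\<integral>x. x \<partial>std_normal_distribution) = 0"
    using integral_std_normal_distribution_moment_odd[of 1] by simp
  have e2: "(\<integral>x. x^2 \<partial>std_normal_distribution) = 1"
    using std_normal_distribution_even_moments(1)[of 1] by simp
  show "integrable N (\<lambda>x. \<theta> \<bullet> x)"
    by (subst tr_int[of "\<lambda>x. x"]) (auto intro: m1)
  show "(\<integral>x. \<theta> \<bullet> x \<partial>N) = 0"
    by (subst tr[of "\<lambda>x. x"]) (auto simp: e1)
  show "integrable N (\<lambda>x. (\<theta> \<bullet> x)\<^sup>2)"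
    unfolding tr_int[of "\<lambda>x. x\<^sup>2", simplified] power_mult_distrib
    by (rule integrable_mult_right) (rule integrable_std_normal_distribution_moment)
  show "(\<integral>x. (\<theta> \<bullet> x)\<^sup>2 \<partial>N) = q"
    unfolding tr[of "\<lambda>x. x\<^sup>2", simplified] power_mult_distrib
    using q by (simp add: e2)
qed

section \<open>Characteristic functions, Gaussian bumps and smoothing\<close>

lemma measurable_cis [measurable]: "cis \<in> borel_measurable borel"
  by (intro borel_measurable_continuous_onI continuous_intros)

lemma integrable_cis [simp]:
  assumes "prob_space M" "f \<in> borel_measurable M"
  shows "integrable M (\<lambda>x. cis (f x))"
proof -
  interpret prob_space M by fact
  show ?thesis
    using assms(2) by (intro integrable_const_bound[where B=1]) (auto simp: cis_conv_exp)
qed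

text \<open>The bump is the characteristic function of \<open>std_gaussian\<close> at
  \<open>\<sigma> *\<^sub>R (x - y)\<close>; exchanging the two integrals turns its expectation into
  an average of values of the characteristic function of \<open>L\<close>. Here
  \<open>\<sigma>\<close> is the inverse of the width of the bump.\<close>

lemma integral_std_gaussian_char:
  fixes L :: "'a::euclidean_space measure"
  assumes L: "prob_space L" "sets L = sets borel"
  shows "complex_of_real (\<integral>x. exp (- (\<sigma>\<^sup>2 * ((x - y) \<bullet> (x - y))) / 2) \<partial>L) =
    (\<integral>\<theta>. cis (- (\<sigma> * (\<theta> \<bullet> y))) * (\<integral>x. cis ((\<sigma> *\<^sub>R \<theta>) \<bullet> x) \<partial>L) \<partial>std_gaussian)"
proof -
  interpret L: prob_space L by fact
  interpret N: prob_space "std_gaussian :: 'a measure" by (rule prob_space_std_gaussian)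
  interpret P: pair_prob_space L "std_gaussian :: 'a measure" ..
  note L(2)[measurable_cong]
  have "complex_of_real (\<integral>x. exp (- (\<sigma>\<^sup>2 * ((x - y) \<bullet> (x - y))) / 2) \<partial>L)
      = (\<integral>x. (\<integral>\<theta>. cis ((\<sigma> *\<^sub>R (x - y)) \<bullet> \<theta>) \<partial>std_gaussian) \<partial>L)"
    unfolding char_std_gaussian
    by (simp add: power2_eq_square mult.assoc)
  also have "\<dots> = (\<integral>\<theta>. (\<integral>x. cis ((\<sigma> *\<^sub>R (x - y)) \<bullet> \<theta>) \<partial>L) \<partial>std_gaussian)"
    by (rule P.Fubini_integral[symmetric])
       (auto intro!: P.integrable_const_bound[where B=1] simp: cis_conv_exp split_beta')
  also have "\<dots> = (\<integral>\<theta>. (\<integral>x. cis (- (\<sigma> * (\<theta> \<bullet> y))) * cis ((\<sigma> *\<^sub>R \<theta>) \<bullet> x) \<partial>L) \<partial>std_gaussian)"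
    by (intro Bochner_Integration.integral_cong refl)
       (simp add: cis_mult inner_diff_left inner_diff_right inner_commute right_diff_distrib)
  finally show ?thesis by simp
qed

text \<open>Substituting y = x + \<sigma> z exhibits the smoothed function as a convolution with a
  bump of width \<open>\<sigma>\<close>, hence the parameter \<open>1/\<sigma>\<close> in the
  exponent, in the shape that \<open>integral_std_gaussian_char\<close> handles.\<close>

lemma std_gaussian_affine:
  fixes f :: "'a::euclidean_space \<Rightarrow> real"
  assumes [measurable]: "f \<in> borel_measurable borel" and \<sigma>: "0 < \<sigma>"
  shows "(\<integral>z. f (x + \<sigma> *\<^sub>R z) \<partial>std_gaussian) =
    (1 / (\<sigma> * sqrt (2 * pi))) ^ DIM('a) *
    (\<integral>y. f y * exp (- ((1/\<sigma>)\<^sup>2 * ((x - y) \<bullet> (x - y))) / 2) \<partial>lborel)"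
proof -
  let ?e = "\<lambda>y. exp (- ((1/\<sigma>)\<^sup>2 * ((x - y) \<bullet> (x - y))) / 2)"
  have dens: "(\<Prod>b\<in>Basis. std_normal_density (z \<bullet> b)) = (1 / sqrt (2 * pi)) ^ DIM('a) * exp (- (z \<bullet> z) / 2)"
    for z :: 'a
  proof -
    have "(\<Prod>b\<in>Basis. exp (- (z \<bullet> b)\<^sup>2 / 2)) = exp (- (z \<bullet> z) / 2)"
      unfolding exp_sum[OF finite_Basis, symmetric] euclidean_inner[of z z]
      by (simp add: sum_negf sum_divide_distrib power2_eq_square)
    moreover have "std_normal_density x = 1 / sqrt (2 * pi) * exp (- x\<^sup>2 / 2)" for x
      by (simp add: normal_density_def)
    ultimately show ?thesis
      by (simp only: prod.distrib prod_constant)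
  qed
  have "(\<integral>y. f y * ?e y \<partial>lborel) =
      \<sigma> ^ DIM('a) * (\<integral>z. f (x + \<sigma> *\<^sub>R z) * exp (- (z \<bullet> z) / 2) \<partial>lborel)"
  proof -
    have "(\<integral>y. f y * ?e y \<partial>lborel) =
        (\<integral>y. \<sigma> ^ DIM('a) *\<^sub>R (f y * ?e y) \<partial>distr lborel borel (\<lambda>z. x + \<sigma> *\<^sub>R z))"
      using \<sigma> by (subst lborel_affine[of \<sigma> x], simp, subst integral_density) auto
    also have "\<dots> = (\<integral>z. \<sigma> ^ DIM('a) *\<^sub>R (f (x + \<sigma> *\<^sub>R z) * ?e (x + \<sigma> *\<^sub>R z)) \<partial>lborel)"
      by (rule integral_distr) auto
    also have "(\<lambda>z. ?e (x + \<sigma> *\<^sub>R z)) = (\<lambda>z. exp (- (z \<bullet> z) / 2))"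
      using \<sigma> by (simp add: power2_eq_square fun_eq_iff)
    finally show ?thesis by simp
  qed
  also have "(\<integral>z. f (x + \<sigma> *\<^sub>R z) * exp (- (z \<bullet> z) / 2) \<partial>lborel) =
      sqrt (2 * pi) ^ DIM('a) * (\<integral>z. f (x + \<sigma> *\<^sub>R z) \<partial>std_gaussian)"
  proof -
    have "(\<integral>z. f (x + \<sigma> *\<^sub>R z) \<partial>std_gaussian) =
        (\<integral>z. (1 / sqrt (2 * pi)) ^ DIM('a) * (f (x + \<sigma> *\<^sub>R z) * exp (- (z \<bullet> z) / 2)) \<partial>lborel)"
      unfolding std_gaussian_def
      by (subst integral_density) (auto simp: prod_nonneg dens mult_ac)
    then show ?thesis
      by (simp add: power_one_over)
  qed
  finally show ?thesis
    using \<sigma> by (simp add: power_divide power_mult_distrib)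
qed

lemma std_gaussian_inner:
  fixes \<theta> :: "'a::euclidean_space"
  shows "integrable std_gaussian (\<lambda>x. \<theta> \<bullet> x)" "(\<integral>x. \<theta> \<bullet> x \<partial>std_gaussian) = 0"
    "integrable std_gaussian (\<lambda>x. (\<theta> \<bullet> x)\<^sup>2)" "(\<integral>x. (\<theta> \<bullet> x)\<^sup>2 \<partial>std_gaussian) = \<theta> \<bullet> \<theta>"
proof -
  have char: "(\<integral>x. cis (s * (\<theta> \<bullet> x)) \<partial>std_gaussian) = complex_of_real (exp (- (s\<^sup>2 * (\<theta> \<bullet> \<theta>)) / 2))" for s
    using char_std_gaussian[of "s *\<^sub>R \<theta>"] by (simp add: power2_eq_square mult.assoc)
  note * = gaussian_char_moments[OF prob_space_std_gaussian sets_std_gaussian char inner_ge_zero]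
  show "integrable std_gaussian (\<lambda>x. \<theta> \<bullet> x)" "(\<integral>x. \<theta> \<bullet> x \<partial>std_gaussian) = 0"
    "integrable std_gaussian (\<lambda>x. (\<theta> \<bullet> x)\<^sup>2)" "(\<integral>x. (\<theta> \<bullet> x)\<^sup>2 \<partial>std_gaussian) = \<theta> \<bullet> \<theta>"
    by (rule *)+
qed

lemma integrable_std_gaussian_norm2:
  "integrable std_gaussian (\<lambda>x::'a::euclidean_space. x \<bullet> x)"
proof -
  have "integrable std_gaussian (\<lambda>x::'a. \<Sum>b\<in>Basis. (b \<bullet> x)\<^sup>2)"
    by (intro Bochner_Integration.integrable_sum std_gaussian_inner)
  moreover have "(\<Sum>b\<in>Basis. (b \<bullet> x)\<^sup>2) = x \<bullet> x" for x :: 'a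
    by (subst euclidean_inner[of x x]) (simp add: power2_eq_square inner_commute)
  ultimately show ?thesis by simp
qed

lemma uniformly_continuous_on_compact_support:
  fixes f :: "'a::euclidean_space \<Rightarrow> real"
  assumes cont: "continuous_on UNIV f" and supp: "\<And>x. r < norm x \<Longrightarrow> f x = 0"
  shows "uniformly_continuous_on UNIV f"
  unfolding uniformly_continuous_on_def
proof (intro allI impI)
  fix e :: real assume e: "0 < e"
  have "uniformly_continuous_on (cball 0 (r + 1)) f"
    by (intro compact_uniformly_continuous continuous_on_subset[OF cont]) auto
  then obtain d where d: "0 < d"
    "\<And>x x'. x \<in> cball 0 (r + 1) \<Longrightarrow> x' \<in> cball 0 (r + 1) \<Longrightarrow> dist x' x < d \<Longrightarrow> dist (f x') (f x) < e"
    using e unfolding uniformly_continuous_on_def by metis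
  show "\<exists>d>0. \<forall>x\<in>UNIV. \<forall>x'\<in>UNIV. dist x' x < d \<longrightarrow> dist (f x') (f x) < e"
  \<comment> \<open>Two points at distance below 1 either both lie in the ball of radius
    \<open>r + 1\<close>, or both lie outside the ball of radius \<open>r\<close>, where
    \<open>f\<close> vanishes.\<close>
  proof (intro exI[of _ "min d 1"] conjI ballI impI)
    fix x x' :: 'a assume x: "dist x' x < min d 1"
    show "dist (f x') (f x) < e"
    proof (cases "norm x \<le> r + 1 \<and> norm x' \<le> r + 1")
      case True
      then show ?thesis using d(2)[of x x'] x by simp
    next
      case False
      moreover have "norm x \<le> norm x' + dist x' x" "norm x' \<le> norm x + dist x' x"
        by norm+
      ultimately have "r < norm x" "r < norm x'"
        using x by auto
      then show ?thesis using e by (simp add: supp)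
    qed
  qed (use d in auto)
qed

text \<open>A Chebyshev-type estimate: the increment of \<open>f\<close> is dominated by a constant
  plus a multiple of the squared displacement, whose Gaussian mean is finite. The modulus of
  continuity is uniform, so one \<open>\<sigma>\<close> serves all \<open>x\<close>.\<close>

lemma gaussian_smoothing_approx:
  fixes f :: "'a::euclidean_space \<Rightarrow> real"
  assumes uc: "uniformly_continuous_on UNIV f" and bd: "\<And>x. \<bar>f x\<bar> \<le> B" and e: "0 < e"
  obtains \<sigma> where "0 < \<sigma>" "\<And>x. \<bar>(\<integral>z. f (x + \<sigma> *\<^sub>R z) \<partial>std_gaussian) - f x\<bar> \<le> e"
proof -
  interpret N: prob_space "std_gaussian :: 'a measure" by (rule prob_space_std_gaussian)
  have B: "0 \<le> B" using bd[of 0] by linarith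
  obtain d where d: "0 < d" "\<And>x x'. dist x' x < d \<Longrightarrow> dist (f x') (f x) < e / 2"
    using uc half_gt_zero[OF e] unfolding uniformly_continuous_on_def by (metis UNIV_I)
  have [measurable]: "f \<in> borel_measurable borel"
    using uniformly_continuous_imp_continuous[OF uc] by (rule borel_measurable_continuous_onI)
  define C where "C = (\<integral>z. z \<bullet> z \<partial>(std_gaussian :: 'a measure))"
  have C: "0 \<le> C" unfolding C_def by (rule Bochner_Integration.integral_nonneg) simp
  \<comment> \<open>Adding 1 to each factor keeps \<open>X\<close> positive even if \<open>B\<close>
    or \<open>C\<close> is 0, while it still dominates \<open>B * C\<close>. The variance
    \<open>s\<close> defined next makes the quadratic error equal to
    \<open>e / 2 * (B * C / X)\<close>.\<close>
  define X where "X = (B + 1) * (C + 1)"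
  have X: "0 < X" "B * C \<le> X" 
    using B C by (simp_all add: X_def mult_mono)
  define s where "s = e * d\<^sup>2 / (4 * X)"
  define \<sigma> where "\<sigma> = sqrt s"
  have s: "0 < s" using e d X by (simp add: s_def)
  \<comment> \<open>For displacements shorter than \<open>d\<close> uniform continuity gives
    \<open>e / 2\<close>; for longer ones the quadratic term is at least \<open>2 * B\<close>, the
    trivial bound.\<close>
  have modulus: "\<bar>f (x + u) - f x\<bar> \<le> e / 2 + 2 * B / d\<^sup>2 * (u \<bullet> u)" for x u
  proof (cases "norm u < d")
    case True
    then have "\<bar>f (x + u) - f x\<bar> \<le> e / 2"
      using d(2)[of "x + u" x] by (simp add: dist_norm)
    then show ?thesis using B by (simp add: add_increasing2)
  next
    case False
    then have "d\<^sup>2 \<le> u \<bullet> u"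
      using d by (simp add: power2_norm_eq_inner[symmetric] power_mono)
    then have "2 * B \<le> 2 * B / d\<^sup>2 * (u \<bullet> u)"
      using d B by (simp add: field_simps mult_left_mono)
    moreover have "\<bar>f (x + u) - f x\<bar> \<le> 2 * B"
      using bd[of "x + u"] bd[of x] by linarith
    ultimately show ?thesis using e by linarith
  qed
  show ?thesis
  proof (rule that[of \<sigma>])
    show "0 < \<sigma>" using s by (simp add: \<sigma>_def)
    fix x
    have int: "integrable (std_gaussian :: 'a measure) (\<lambda>z. f (x + \<sigma> *\<^sub>R z))"
      by (rule N.integrable_const_bound[where B=B]) (auto simp: bd)
    have "\<bar>(\<integral>z. f (x + \<sigma> *\<^sub>R z) \<partial>std_gaussian) - f x\<bar> = \<bar>\<integral>z. f (x + \<sigma> *\<^sub>R z) - f x \<partial>std_gaussian\<bar>"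
      using int by (simp add: N.prob_space[simplified])
    also have "\<dots> \<le> (\<integral>z. \<bar>f (x + \<sigma> *\<^sub>R z) - f x\<bar> \<partial>std_gaussian)"
      by (rule integral_abs_bound)
    also have "\<dots> \<le> (\<integral>z. e / 2 + (2 * B / d\<^sup>2 * s) * (z \<bullet> z) \<partial>(std_gaussian :: 'a measure))"
    proof (rule Bochner_Integration.integral_mono)
      fix z
      show "\<bar>f (x + \<sigma> *\<^sub>R z) - f x\<bar> \<le> e / 2 + 2 * B / d\<^sup>2 * s * (z \<bullet> z)"
        using modulus[of x "\<sigma> *\<^sub>R z"] s
        by (simp add: \<sigma>_def mult.assoc flip: mult.assoc[of "sqrt s" "sqrt s"])
    qed (use int integrable_std_gaussian_norm2 in \<open>auto intro!: Bochner_Integration.integrable_add\<close>)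
    also have "\<dots> = e / 2 + 2 * B / d\<^sup>2 * s * C"
      unfolding C_def
      by (subst Bochner_Integration.integral_add)
         (auto simp: N.prob_space[simplified] integrable_std_gaussian_norm2 simp del: times_divide_eq_left)
    also have "2 * B / d\<^sup>2 * s * C = e / 2 * (B * C / X)"
      using d X by (simp add: s_def field_simps)
    also have "\<dots> \<le> e / 2 * 1"
      using X e by (intro mult_left_mono) auto
    finally show "\<bar>(\<integral>z. f (x + \<sigma> *\<^sub>R z) \<partial>std_gaussian) - f x\<bar> \<le> e"
      by simp
  qed
qed

section \<open>The continuity theorem for characteristic functions\<close>

text \<open>\<open>M\<close> has total mass 1, so the first marginal of the product is
  \<open>N\<close> itself and integrability is pulled back along \<open>fst\<close>.\<close>

lemma integrable_pair_fst:
  fixes f :: "'a \<Rightarrow> 'b::{banach, second_countable_topology}"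
  assumes "prob_space M" "integrable N f"
  shows "integrable (N \<Otimes>\<^sub>M M) (\<lambda>(x, y). f x)"
proof -
  have "integrable (distr (N \<Otimes>\<^sub>M M) N fst) f"
    using assms by (simp add: prob_space.distr_pair_fst)
  then show ?thesis
    by (subst (asm) integrable_distr_eq) (use assms in \<open>auto simp: split_beta'\<close>)
qed

lemma integrable_pair_snd:
  fixes f :: "'a \<Rightarrow> 'b::{banach, second_countable_topology}"
  assumes "prob_space M" "sigma_finite_measure N" "integrable N f"
  shows "integrable (M \<Otimes>\<^sub>M N) (\<lambda>(x, y). f y)"
proof -
  interpret M: prob_space M by fact
  interpret N: sigma_finite_measure N by fact
  interpret pair_sigma_finite N M ..
  show ?thesis
    using integrable_product_swap[OF integrable_pair_fst[OF assms(1,3)]] by simp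
qed

text \<open>After Fubini the measure \<open>L\<close> enters only through expectations of bumps,
  weighted by \<open>f y\<close>. The bumps are at most 1, so \<open>\<bar>f y\<bar>\<close> is an
  integrable majorant on the product.\<close>

lemma integral_gaussian_smoothing:
  fixes L :: "'a::euclidean_space measure" and f :: "'a \<Rightarrow> real"
  assumes L: "prob_space L" "sets L = sets borel"
    and f: "integrable lborel f" and \<sigma>: "0 < \<sigma>"
  shows "(\<integral>x. \<integral>z. f (x + \<sigma> *\<^sub>R z) \<partial>std_gaussian \<partial>L) =
    (1 / (\<sigma> * sqrt (2 * pi))) ^ DIM('a) *
    (\<integral>y. f y * (\<integral>x. exp (- ((1/\<sigma>)\<^sup>2 * ((x - y) \<bullet> (x - y))) / 2) \<partial>L) \<partial>lborel)"
proof -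
  interpret L: prob_space L by fact
  interpret P: pair_sigma_finite L "lborel :: 'a measure" ..
  note L(2)[measurable_cong]
  have [measurable]: "f \<in> borel_measurable borel"
    using borel_measurable_integrable[OF f] by simp
  let ?e = "\<lambda>x y :: 'a. exp (- ((1/\<sigma>)\<^sup>2 * ((x - y) \<bullet> (x - y))) / 2)"
  have int_f: "integrable (L \<Otimes>\<^sub>M lborel) (\<lambda>(x, y). f y)"
    by (rule integrable_pair_snd[OF L(1) lborel.sigma_finite_measure_axioms f])
  have int: "integrable (L \<Otimes>\<^sub>M lborel) (\<lambda>(x, y). f y * ?e x y)"
    by (rule Bochner_Integration.integrable_bound[OF int_f])
       (auto simp: split_beta' abs_mult intro!: mult_left_le)
  have "(\<integral>x. \<integral>z. f (x + \<sigma> *\<^sub>R z) \<partial>std_gaussian \<partial>L) =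
      (1 / (\<sigma> * sqrt (2 * pi))) ^ DIM('a) * (\<integral>x. \<integral>y. f y * ?e x y \<partial>lborel \<partial>L)"
    using \<sigma> by (simp add: std_gaussian_affine)
  also have "(\<integral>x. \<integral>y. f y * ?e x y \<partial>lborel \<partial>L) = (\<integral>y. \<integral>x. f y * ?e x y \<partial>L \<partial>lborel)"
    by (rule P.Fubini_integral[symmetric]) (rule int)
  finally show ?thesis by simp
qed

text \<open>The Gaussian is its own characteristic function up to scaling, so expectations of Gaussian
  bumps are averages of characteristic functions and converge; a function of compact support is
  uniformly approximated by a superposition of such bumps, namely its convolution with a Gaussian.\<close>

lemma char_limit_compact_support:
  fixes L :: "nat \<Rightarrow> 'a::euclidean_space measure" and Q :: "'a measure" and f :: "'a \<Rightarrow> real"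
  assumes L: "\<And>n. prob_space (L n)" "\<And>n. sets (L n) = sets borel"
    and Q: "prob_space Q" "sets Q = sets borel"
    and char: "\<And>\<theta>. (\<lambda>n. \<integral>x. cis (\<theta> \<bullet> x) \<partial>L n) \<longlonglongrightarrow> (\<integral>x. cis (\<theta> \<bullet> x) \<partial>Q)"
    and cont: "continuous_on UNIV f" and supp: "\<And>x. r < norm x \<Longrightarrow> f x = 0"
  shows "(\<lambda>n. integral\<^sup>L (L n) f) \<longlonglongrightarrow> integral\<^sup>L Q f"
proof (rule LIMSEQ_I)
  fix e :: real assume e: "0 < e"
  interpret N: prob_space "std_gaussian :: 'a measure" by (rule prob_space_std_gaussian)
  have [measurable]: "f \<in> borel_measurable borel"
    using cont by (rule borel_measurable_continuous_onI)
  have "bounded (f ` cball 0 r)"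
    by (intro compact_imp_bounded compact_continuous_image continuous_on_subset[OF cont]) auto
  then obtain B where B: "\<And>x. x \<in> cball 0 r \<Longrightarrow> \<bar>f x\<bar> \<le> B" "0 < B"
    unfolding bounded_pos by (metis imageI real_norm_def)
  have bd: "\<bar>f x\<bar> \<le> B" for x
    using B(1)[of x] B(2) supp[of x] by (cases "norm x \<le> r") auto
  have int_f: "integrable lborel f"
  proof (rule integrableI_bounded_set[where A="cball 0 r" and B=B])
    show "emeasure lborel (cball 0 r :: 'a set) < \<infinity>"
      by (rule emeasure_lborel_cball_finite)
  qed (auto simp: bd supp)
  have uc: "uniformly_continuous_on UNIV f"
    using cont supp by (rule uniformly_continuous_on_compact_support)
  obtain \<sigma> where \<sigma>: "0 < \<sigma>"
    and approx: "\<And>x. \<bar>(\<integral>z. f (x + \<sigma> *\<^sub>R z) \<partial>std_gaussian) - f x\<bar> \<le> e / 4"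
    using gaussian_smoothing_approx[OF uc bd, of "e / 4"] e by auto
  let ?f = "\<lambda>x. \<integral>z. f (x + \<sigma> *\<^sub>R z) \<partial>std_gaussian"
  let ?g = "\<lambda>(M :: 'a measure) (y :: 'a). \<integral>x. exp (- ((1/\<sigma>)\<^sup>2 * ((x - y) \<bullet> (x - y))) / 2) \<partial>M"
  \<comment> \<open>The error budget: \<open>e / 4\<close> for smoothing \<open>f\<close> under
    \<open>L n\<close>, \<open>e / 4\<close> for smoothing it under \<open>Q\<close>, and less than
    \<open>e / 4\<close> between the two smoothed expectations. The first bound is the same for
    every probability measure, hence uniform in \<open>n\<close>.\<close>
  have smooth: "\<bar>integral\<^sup>L M ?f - integral\<^sup>L M f\<bar> \<le> e / 4"
    if M: "prob_space M" "sets M = sets borel" for M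
  proof -
    interpret M: prob_space M by (rule M)
    note M(2)[measurable_cong]
    have int: "integrable M f"
      by (rule M.integrable_const_bound[where B=B]) (auto simp: bd)
    have "\<bar>?f x\<bar> \<le> B + e / 4" for x
      using approx[of x] bd[of x] by linarith
    then have int': "integrable M ?f"
      by (intro M.integrable_const_bound[where B="B + e / 4"]) auto
    have "\<bar>integral\<^sup>L M ?f - integral\<^sup>L M f\<bar> = \<bar>\<integral>x. ?f x - f x \<partial>M\<bar>"
      using int int' by simp
    also have "\<dots> \<le> (\<integral>x. \<bar>?f x - f x\<bar> \<partial>M)"
      by (rule integral_abs_bound)
    also have "\<dots> \<le> (\<integral>x. e / 4 \<partial>M)"
      by (rule Bochner_Integration.integral_mono) (use int int' approx in auto)
    finally show ?thesis by (simp add: M.prob_space)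
  qed
  \<comment> \<open>Bump expectations are Gaussian averages of characteristic functions, which
    converge pointwise and are bounded by 1.\<close>
  have g_lim: "(\<lambda>n. ?g (L n) y) \<longlonglongrightarrow> ?g Q y" for y
  proof -
    have "(\<lambda>n. complex_of_real (?g (L n) y)) \<longlonglongrightarrow> complex_of_real (?g Q y)"
      unfolding integral_std_gaussian_char[OF L] integral_std_gaussian_char[OF Q]
    proof (rule integral_dominated_convergence[where w="\<lambda>_. 1"])
      show "AE \<theta> in std_gaussian. (\<lambda>n. cis (- (1/\<sigma> * (\<theta> \<bullet> y))) * (\<integral>x. cis (((1/\<sigma>) *\<^sub>R \<theta>) \<bullet> x) \<partial>L n))
          \<longlonglongrightarrow> cis (- (1/\<sigma> * (\<theta> \<bullet> y))) * (\<integral>x. cis (((1/\<sigma>) *\<^sub>R \<theta>) \<bullet> x) \<partial>Q)"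
        by (intro AE_I2 tendsto_mult tendsto_const char)
      show "AE \<theta> in std_gaussian. norm (cis (- (1/\<sigma> * (\<theta> \<bullet> y))) * (\<integral>x. cis (((1/\<sigma>) *\<^sub>R \<theta>) \<bullet> x) \<partial>L n)) \<le> 1" for n
      proof (intro AE_I2)
        fix \<theta> :: 'a
        interpret Ln: prob_space "L n" by (rule L)
        have "norm (\<integral>x. cis (((1/\<sigma>) *\<^sub>R \<theta>) \<bullet> x) \<partial>L n) \<le> (\<integral>x. norm (cis (((1/\<sigma>) *\<^sub>R \<theta>) \<bullet> x)) \<partial>L n)"
          by (rule integral_norm_bound)
        then show "norm (cis (- (1/\<sigma> * (\<theta> \<bullet> y))) * (\<integral>x. cis (((1/\<sigma>) *\<^sub>R \<theta>) \<bullet> x) \<partial>L n)) \<le> 1"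
          by (simp add: norm_mult Ln.prob_space)
      qed
      show "(\<lambda>\<theta>. cis (- (1/\<sigma> * (\<theta> \<bullet> y))) * (\<integral>x. cis (((1/\<sigma>) *\<^sub>R \<theta>) \<bullet> x) \<partial>L n)) \<in> borel_measurable std_gaussian" for n
      proof -
        interpret Ln: prob_space "L n" by (rule L)
        note L(2)[of n, measurable_cong]
        show ?thesis by measurable
      qed
      show "(\<lambda>\<theta>. cis (- (1/\<sigma> * (\<theta> \<bullet> y))) * (\<integral>x. cis (((1/\<sigma>) *\<^sub>R \<theta>) \<bullet> x) \<partial>Q)) \<in> borel_measurable std_gaussian"
      proof -
        interpret Q: prob_space Q by (rule Q)
        note Q(2)[measurable_cong]
        show ?thesis by measurable
      qed
    qed simp
    then show ?thesis by (simp only: tendsto_of_real_iff)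
  qed
  have g_meas: "?g M \<in> borel_measurable borel" if M: "prob_space M" "sets M = sets borel" for M
  proof -
    interpret M: prob_space M by (rule M)
    note M(2)[measurable_cong]
    show ?thesis by measurable
  qed
  have g_bd: "\<bar>?g M y\<bar> \<le> 1" if M: "prob_space M" "sets M = sets borel" for M y
  proof -
    interpret M: prob_space M by (rule M)
    note M(2)[measurable_cong]
    have int: "integrable M (\<lambda>x. exp (- ((1/\<sigma>)\<^sup>2 * ((x - y) \<bullet> (x - y))) / 2))"
      by (rule M.integrable_const_bound[where B=1]) auto
    have "?g M y \<le> (\<integral>x. 1 \<partial>M)"
      by (rule Bochner_Integration.integral_mono[OF int]) auto
    moreover have "0 \<le> ?g M y"
      by (rule Bochner_Integration.integral_nonneg) auto
    ultimately show ?thesis by (simp add: M.prob_space)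
  qed
  \<comment> \<open>Compact support makes \<open>\<bar>f y\<bar>\<close> Lebesgue integrable, and it
    dominates because the bump expectations lie between 0 and 1.\<close>
  have "(\<lambda>n. \<integral>y. f y * ?g (L n) y \<partial>lborel) \<longlonglongrightarrow> (\<integral>y. f y * ?g Q y \<partial>lborel)"
  proof (rule integral_dominated_convergence[where w="\<lambda>y. \<bar>f y\<bar>"])
    show "AE y in lborel. norm (f y * ?g (L n) y) \<le> \<bar>f y\<bar>" for n
      by (intro AE_I2) (use g_bd[OF L] in \<open>auto simp: abs_mult intro!: mult_left_le\<close>)
  qed (use g_lim g_meas[OF L] g_meas[OF Q] int_f in \<open>auto intro!: tendsto_intros\<close>)
  then have lim: "(\<lambda>n. integral\<^sup>L (L n) ?f) \<longlonglongrightarrow> integral\<^sup>L Q ?f"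
    unfolding integral_gaussian_smoothing[OF L int_f \<sigma>] integral_gaussian_smoothing[OF Q int_f \<sigma>]
    by (intro tendsto_mult tendsto_const)
  obtain n0 where n0: "\<forall>n\<ge>n0. norm (integral\<^sup>L (L n) ?f - integral\<^sup>L Q ?f) < e / 4"
    using LIMSEQ_D[OF lim, of "e / 4"] e by auto
  show "\<exists>no. \<forall>n\<ge>no. norm (integral\<^sup>L (L n) f - integral\<^sup>L Q f) < e"
  proof (intro exI[of _ n0] allI impI)
    fix n assume "n0 \<le> n"
    then show "norm (integral\<^sup>L (L n) f - integral\<^sup>L Q f) < e"
      using n0[rule_format, of n] smooth[OF L, of n] smooth[OF Q] e by (simp add: abs_if split: if_splits)
  qed
qed

text \<open>Tightness comes for free: applying the compactly supported case to cutoff functions shows that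
  no mass escapes, because the limit is a probability measure.\<close>

lemma levy_continuity_euclidean:
  fixes L :: "nat \<Rightarrow> 'a::euclidean_space measure" and Q :: "'a measure"
  assumes L: "\<And>n. prob_space (L n)" "\<And>n. sets (L n) = sets borel"
    and Q: "prob_space Q" "sets Q = sets borel"
    and char: "\<And>\<theta>. (\<lambda>n. \<integral>x. cis (\<theta> \<bullet> x) \<partial>L n) \<longlonglongrightarrow> (\<integral>x. cis (\<theta> \<bullet> x) \<partial>Q)"
  shows "conv_distr L Q sequentially"
  unfolding conv_distr_def
proof (intro allI impI LIMSEQ_I)
  fix f :: "'a \<Rightarrow> real" and e :: real
  assume cont: "continuous_on UNIV f" and "bounded (range f)" and e: "0 < e"
  then obtain B where B: "\<And>x. \<bar>f x\<bar> \<le> B" "0 < B"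
    by (auto simp: bounded_pos)
  \<comment> \<open>A continuous cutoff: 1 on the ball of radius \<open>k\<close>, 0 outside the
    ball of radius \<open>k + 1\<close>, linear in the norm between.\<close>
  define \<psi> where "\<psi> k x = max 0 (min 1 (real k + 1 - norm x))" for k :: nat and x :: 'a
  have \<psi>: "0 \<le> \<psi> k x" "\<psi> k x \<le> 1" for k x by (auto simp: \<psi>_def)
  have \<psi>_cont: "continuous_on UNIV (\<psi> k)" for k
    unfolding \<psi>_def by (intro continuous_intros)
  have \<psi>_supp: "\<psi> k x = 0" if "real k + 1 < norm x" for k x
    using that by (simp add: \<psi>_def)
  have [measurable]: "f \<in> borel_measurable borel" "\<psi> k \<in> borel_measurable borel" for k
    using cont \<psi>_cont by (auto intro!: borel_measurable_continuous_onI)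
  \<comment> \<open>Truncating \<open>f\<close> costs at most \<open>B\<close> times the mass that
    the cutoff misses.\<close>
  have cut: "\<bar>integral\<^sup>L M f - (\<integral>x. f x * \<psi> k x \<partial>M)\<bar> \<le> B * (1 - integral\<^sup>L M (\<psi> k))"
    if M: "prob_space M" "sets M = sets borel" for M k
  proof -
    interpret M: prob_space M by (rule M)
    note M(2)[measurable_cong]
    have int: "integrable M f" "integrable M (\<psi> k)" "integrable M (\<lambda>x. f x * \<psi> k x)"
    proof -
      show "integrable M f"
        by (rule M.integrable_const_bound[where B=B]) (auto simp: B)
      show "integrable M (\<psi> k)"
        by (rule M.integrable_const_bound[where B=1]) (auto simp: \<psi>)
      have "\<bar>f x\<bar> * \<psi> k x \<le> B * 1" for x
        using B \<psi> by (intro mult_mono) auto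
      then show "integrable M (\<lambda>x. f x * \<psi> k x)"
        by (intro M.integrable_const_bound[where B=B]) (auto simp: abs_mult \<psi>)
    qed
    have "\<bar>integral\<^sup>L M f - (\<integral>x. f x * \<psi> k x \<partial>M)\<bar> = \<bar>\<integral>x. f x - f x * \<psi> k x \<partial>M\<bar>"
      using int by simp
    also have "\<dots> \<le> (\<integral>x. \<bar>f x - f x * \<psi> k x\<bar> \<partial>M)"
      by (rule integral_abs_bound)
    also have "\<dots> \<le> (\<integral>x. B * (1 - \<psi> k x) \<partial>M)"
    proof (rule Bochner_Integration.integral_mono)
      fix x
      have "\<bar>f x - f x * \<psi> k x\<bar> = \<bar>f x\<bar> * (1 - \<psi> k x)"
        using \<psi>[of k x] abs_mult[of "f x" "1 - \<psi> k x"] by (simp add: right_diff_distrib)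
      also have "\<dots> \<le> B * (1 - \<psi> k x)"
        using B(1) \<psi> by (intro mult_right_mono) auto
      finally show "\<bar>f x - f x * \<psi> k x\<bar> \<le> B * (1 - \<psi> k x)" .
    qed (use int in auto)
    also have "\<dots> = B * (1 - integral\<^sup>L M (\<psi> k))"
      using int by (simp add: M.prob_space right_diff_distrib)
    finally show ?thesis .
  qed
  interpret Q: prob_space Q by (rule Q)
  note Q(2)[measurable_cong]
  have "(\<lambda>k. integral\<^sup>L Q (\<psi> k)) \<longlonglongrightarrow> (\<integral>x. 1 \<partial>Q)"
  proof (rule integral_dominated_convergence[where w="\<lambda>_. 1"])
    show "AE x in Q. (\<lambda>k. \<psi> k x) \<longlonglongrightarrow> 1"
    proof (intro AE_I2 tendsto_eventually)
      fix x :: 'a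
      obtain k0 where "norm x \<le> real k0" using real_arch_simple by blast
      then show "\<forall>\<^sub>F k in sequentially. \<psi> k x = 1"
        by (intro eventually_sequentiallyI[of k0]) (auto simp: \<psi>_def)
    qed
  qed (use \<psi> in auto)
  \<comment> \<open>The missed mass is kept below \<open>e / (8 * B)\<close>, so each of the two
    truncations, under \<open>Q\<close> and under \<open>L n\<close>, costs at most
    \<open>e / 8\<close>; the truncated integrals will differ by less than
    \<open>e / 4\<close>.\<close>
  then have "\<forall>\<^sub>F k in sequentially. 1 - e / (8 * B) < integral\<^sup>L Q (\<psi> k)"
    using e B by (intro order_tendstoD) (auto simp: Q.prob_space)
  then obtain k where k: "1 - e / (8 * B) < integral\<^sup>L Q (\<psi> k)"
    by (auto simp: eventually_sequentially)
  have "(\<lambda>n. integral\<^sup>L (L n) (\<psi> k)) \<longlonglongrightarrow> integral\<^sup>L Q (\<psi> k)"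
    using char_limit_compact_support[OF L Q char \<psi>_cont \<psi>_supp] by blast
  then have ev1: "\<forall>\<^sub>F n in sequentially. 1 - e / (8 * B) < integral\<^sup>L (L n) (\<psi> k)"
    using k by (rule order_tendstoD)
  have "(\<lambda>n. \<integral>x. f x * \<psi> k x \<partial>L n) \<longlonglongrightarrow> (\<integral>x. f x * \<psi> k x \<partial>Q)"
    by (rule char_limit_compact_support[OF L Q char, where r="real k + 1"])
       (auto intro!: continuous_intros cont \<psi>_cont simp: \<psi>_supp)
  then have ev2: "\<forall>\<^sub>F n in sequentially. \<bar>(\<integral>x. f x * \<psi> k x \<partial>L n) - (\<integral>x. f x * \<psi> k x \<partial>Q)\<bar> < e / 4"
    using e by (auto simp: tendsto_iff dist_real_def dest!: spec[where x="e / 4"])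
  have "\<forall>\<^sub>F n in sequentially. norm (integral\<^sup>L (L n) f - integral\<^sup>L Q f) < e"
    using ev1 ev2
  proof eventually_elim
    case (elim n)
    have small: "B * (1 - integral\<^sup>L M (\<psi> k)) \<le> e / 8" if "1 - e / (8 * B) < integral\<^sup>L M (\<psi> k)" for M
      using that B(2) by (simp add: field_simps)
    show ?case
      using elim(2) small[OF elim(1)] small[OF k] cut[OF L, of n k] cut[OF Q, of k] e
      by (simp add: abs_if split: if_splits)
  qed
  then show "\<exists>no. \<forall>n\<ge>no. norm (integral\<^sup>L (L n) f - integral\<^sup>L Q f) < e"
    by (simp add: eventually_sequentially)
qed

section \<open>Linear differential equations\<close>

text \<open>The series of exp(tL) x for an operator given as a function. This covers both left
  multiplication by a matrix and the generator of the flow on pairs of matrices, without choosing a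
  matrix for the latter.\<close>

definition lexp :: "('a::real_normed_vector \<Rightarrow> 'a) \<Rightarrow> real \<Rightarrow> 'a \<Rightarrow> 'a" where
  "lexp L t x = (\<Sum>n. (t ^ n / fact n) *\<^sub>R (L ^^ n) x)"

lemma norm_funpow_le:
  fixes L :: "'a::real_normed_vector \<Rightarrow> 'a"
  assumes "\<And>x. norm (L x) \<le> C * norm x" "0 \<le> C"
  shows "norm ((L ^^ n) x) \<le> C ^ n * norm x"
proof (induction n)
  case (Suc n)
  have "norm ((L ^^ Suc n) x) \<le> C * norm ((L ^^ n) x)"
    using assms(1) by simp
  also have "\<dots> \<le> C * (C ^ n * norm x)"
    by (intro mult_left_mono Suc assms)
  finally show ?case by (simp add: mult.assoc)
qed simp

lemma summable_exp_scaled: "summable (\<lambda>n. (r ^ n / fact n) * (C ^ n * y))" for r C y :: real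
proof -
  have "summable (\<lambda>n. inverse (fact n) * (r * C) ^ n * y)"
    by (intro summable_mult2 summable_exp)
  then show ?thesis
    by (simp add: power_mult_distrib field_simps)
qed

lemma lexp_term_bound:
  fixes L :: "'a::real_normed_vector \<Rightarrow> 'a"
  assumes "\<And>x. norm (L x) \<le> C * norm x" "0 \<le> C" "\<bar>t\<bar> \<le> r"
  shows "norm ((t ^ n / fact n) *\<^sub>R (L ^^ n) x) \<le> (r ^ n / fact n) * (C ^ n * norm x)"
proof -
  have "\<bar>t ^ n / fact n\<bar> \<le> r ^ n / fact n"
    using assms(3) by (simp add: power_abs divide_right_mono power_mono)
  then show ?thesis
    unfolding norm_scaleR real_norm_def
    using norm_funpow_le[of L C n x, OF assms(1,2)] assms(3) by (intro mult_mono) auto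
qed

lemma summable_lexp:
  fixes L :: "'a::banach \<Rightarrow> 'a"
  assumes "\<And>x. norm (L x) \<le> C * norm x" "0 \<le> C"
  shows "summable (\<lambda>n. (t ^ n / fact n) *\<^sub>R (L ^^ n) x)"
  using lexp_term_bound[OF assms order_refl, of t _ x]
  by (intro summable_comparison_test'[OF summable_exp_scaled[of "\<bar>t\<bar>" C "norm x"], of 0]) blast

lemma lexp_0 [simp]: "lexp L 0 x = x"
proof -
  have "lexp L 0 x = (\<Sum>n\<in>{0}. (0 ^ n / fact n) *\<^sub>R (L ^^ n) x)"
    unfolding lexp_def by (rule suminf_finite) auto
  then show ?thesis by simp
qed

text \<open>Termwise differentiation: on a ball around 0 that contains \<open>t\<close> the
  differentiated series converges uniformly by the M-test, and after an index shift it is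
  \<open>L\<close> applied to the original series.\<close>

lemma lexp_has_vector_derivative:
  fixes L :: "'a::banach \<Rightarrow> 'a"
  assumes L: "linear L" "\<And>x. norm (L x) \<le> C * norm x" "0 \<le> C"
  shows "((\<lambda>t. lexp L t x) has_vector_derivative L (lexp L t x)) (at t)"
proof -
  define r where "r = \<bar>t\<bar> + 1"
  let ?v = "\<lambda>n. (L ^^ n) x"
  let ?f = "\<lambda>n (t::real). (t ^ n / fact n) *\<^sub>R ?v n"
  let ?d = "\<lambda>n (t::real). (real n * t ^ (n - 1) / fact n) *\<^sub>R ?v n"
  \<comment> \<open>The term of \<open>?d\<close> at index 0 vanishes through its factor
    \<open>real n\<close>, despite the truncated exponent \<open>n - 1\<close>. At index
    \<open>Suc m\<close> one application of \<open>L\<close> is moved onto \<open>x\<close>, at the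
    cost of a factor \<open>C\<close>.\<close>
  let ?M = "\<lambda>n. case n of 0 \<Rightarrow> 0 | Suc m \<Rightarrow> (r ^ m / fact m) * (C ^ m * (C * norm x))"
  have blin: "bounded_linear L"
    using L(1,2) by (auto simp: bounded_linear_def bounded_linear_axioms_def mult.commute)
  have d_Suc: "?d (Suc n) t = (t ^ n / fact n) *\<^sub>R L (?v n)" for n t
    by (simp add: field_simps del: of_nat_Suc)
  have bound: "norm (?d n t) \<le> ?M n" if "t \<in> ball 0 r" for n t
  proof (cases n)
    case (Suc m)
    have "norm (?d n t) = norm ((t ^ m / fact m) *\<^sub>R (L ^^ m) (L x))"
      unfolding Suc d_Suc by (simp add: funpow_swap1)
    also have "\<dots> \<le> (r ^ m / fact m) * (C ^ m * norm (L x))"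
      using that by (intro lexp_term_bound L) auto
    also have "\<dots> \<le> (r ^ m / fact m) * (C ^ m * (C * norm x))"
      using L by (intro mult_left_mono) (auto simp: r_def)
    finally show ?thesis by (simp add: Suc)
  qed simp
  have "summable ?M"
    by (subst summable_Suc_iff[symmetric]) (use summable_exp_scaled[of r C "C * norm x"] in simp)
  then have unif: "uniform_limit (ball 0 r) (\<lambda>n t. \<Sum>i<n. ?d i t) (\<lambda>t. suminf (\<lambda>i. ?d i t)) sequentially"
    by (intro Weierstrass_m_test) (rule bound)
  have d_sum: "suminf (\<lambda>i. ?d i s) = L (lexp L s x)" if "s \<in> ball 0 r" for s
  proof -
    have "summable (\<lambda>i. ?d i s)"
      by (rule summable_comparison_test'[OF \<open>summable ?M\<close>]) (rule bound[OF that])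
    then have "suminf (\<lambda>i. ?d i s) = (\<Sum>n. ?d (Suc n) s)"
      by (subst suminf_split_head) auto
    also have "\<dots> = (\<Sum>n. L ((s ^ n / fact n) *\<^sub>R ?v n))"
      unfolding d_Suc using L(1) by (simp add: linear_cmul)
    also have "\<dots> = L (lexp L s x)"
      unfolding lexp_def
      by (rule bounded_linear.suminf[OF blin, symmetric]) (rule summable_lexp[OF L(2,3)])
    finally show ?thesis .
  qed
  have "\<exists>g. \<forall>s\<in>ball 0 r. (\<lambda>n. ?f n s) sums g s \<and>
      (g has_derivative (\<lambda>h. h *\<^sub>R L (lexp L s x))) (at s within ball 0 r)"
  proof (rule has_derivative_series)
    show "(?f n has_derivative (\<lambda>h. h *\<^sub>R ?d n s)) (at s within ball 0 r)" for n s
      by (auto intro!: derivative_eq_intros)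
    show "(\<lambda>n. ?f n 0) sums lexp L 0 x"
      unfolding lexp_def by (rule summable_sums) (rule summable_lexp[OF L(2,3)])
    show "(0::real) \<in> ball 0 r" by (simp add: r_def)
    fix e :: real assume "0 < e"
    with unif have "\<forall>\<^sub>F n in sequentially. \<forall>s\<in>ball 0 r. dist (\<Sum>i<n. ?d i s) (suminf (\<lambda>i. ?d i s)) < e"
      by (rule uniform_limitD)
    then show "\<forall>\<^sub>F n in sequentially. \<forall>s\<in>ball 0 r. \<forall>h.
        norm ((\<Sum>i<n. h *\<^sub>R ?d i s) - h *\<^sub>R L (lexp L s x)) \<le> e * norm h"
    proof eventually_elim
      case (elim n)
      show ?case
      proof (intro ballI allI)
        fix s h :: real assume s: "s \<in> ball 0 r"
        have "norm ((\<Sum>i<n. h *\<^sub>R ?d i s) - h *\<^sub>R L (lexp L s x)) =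
            \<bar>h\<bar> * norm ((\<Sum>i<n. ?d i s) - L (lexp L s x))"
          by (simp only: scaleR_sum_right[symmetric] scaleR_diff_right[symmetric] norm_scaleR)
        also have "\<dots> \<le> \<bar>h\<bar> * e"
          using elim[rule_format, OF s] unfolding dist_norm d_sum[OF s]
          by (rule mult_left_mono[OF less_imp_le]) auto
        finally show "norm ((\<Sum>i<n. h *\<^sub>R ?d i s) - h *\<^sub>R L (lexp L s x)) \<le> e * norm h"
          by (simp add: mult.commute)
      qed
    qed
  qed auto
  then obtain g where g: "\<And>s. s \<in> ball 0 r \<Longrightarrow> (\<lambda>n. ?f n s) sums g s"
    "\<And>s. s \<in> ball 0 r \<Longrightarrow> (g has_derivative (\<lambda>h. h *\<^sub>R L (lexp L s x))) (at s within ball 0 r)"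
    by blast
  have t: "t \<in> ball 0 r" by (simp add: r_def)
  have "(g has_vector_derivative L (lexp L t x)) (at t)"
    using g(2)[OF t] t by (simp add: has_vector_derivative_def at_within_open[OF t open_ball])
  then show ?thesis
  proof (rule has_vector_derivative_transform_within_open)
    show "g s = lexp L s x" if "s \<in> ball 0 r" for s
      using g(1)[OF that] by (simp add: lexp_def sums_iff)
  qed (use t in auto)
qed

text \<open>Partial sums are continuous in the parameter, but the operator bound \<open>c p\<close>
  need not be bounded globally. Uniform convergence is therefore obtained on a neighbourhood of each
  \<open>p0\<close> where \<open>c\<close> and the norm of the initial vector exceed their values at
  \<open>p0\<close> by less than 1.\<close>

lemma continuous_on_lexp:
  fixes L :: "'p::t2_space \<Rightarrow> 'a::banach \<Rightarrow> 'a"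
  assumes L: "continuous_on UNIV (\<lambda>(p, x). L p x)"
    and x0: "continuous_on UNIV x0"
    and bound: "\<And>p x. norm (L p x) \<le> c p * norm x" "\<And>p. 0 \<le> c p" and c: "continuous_on UNIV c"
  shows "continuous_on UNIV (\<lambda>p. lexp (L p) t (x0 p))"
proof (rule continuous_at_imp_continuous_on, rule ballI)
  fix p0
  have pow: "continuous_on UNIV (\<lambda>p. (L p ^^ n) (x0 p))" for n
  proof (induction n)
    case (Suc n)
    show ?case
      using continuous_on_compose2[OF L continuous_on_Pair[OF continuous_on_id Suc]] by simp
  qed (simp add: x0)
  define U where "U = {p. c p < c p0 + 1} \<inter> {p. norm (x0 p) < norm (x0 p0) + 1}"
  have U: "open U" "p0 \<in> U"
    unfolding U_def by (intro open_Int open_Collect_less continuous_intros c x0) auto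
  have "continuous_on U (\<lambda>p. lexp (L p) t (x0 p))"
    unfolding lexp_def
  proof (rule uniform_limit_theorem[OF _ Weierstrass_m_test])
    show "summable (\<lambda>n. (\<bar>t\<bar> ^ n / fact n) * ((c p0 + 1) ^ n * (norm (x0 p0) + 1)))"
      by (rule summable_exp_scaled)
    show "\<forall>\<^sub>F n in sequentially. continuous_on U (\<lambda>p. \<Sum>i<n. (t ^ i / fact i) *\<^sub>R (L p ^^ i) (x0 p))"
      by (intro always_eventually allI continuous_intros continuous_on_subset[OF pow]) auto
    fix n p assume p: "p \<in> U"
    have "norm ((t ^ n / fact n) *\<^sub>R (L p ^^ n) (x0 p)) \<le> (\<bar>t\<bar> ^ n / fact n) * (c p ^ n * norm (x0 p))"
      by (rule lexp_term_bound[OF bound order_refl])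
    also have "\<dots> \<le> (\<bar>t\<bar> ^ n / fact n) * ((c p0 + 1) ^ n * (norm (x0 p0) + 1))"
      using p bound(2) by (intro mult_left_mono mult_mono power_mono) (auto simp: U_def add_nonneg_nonneg)
    finally show "norm ((t ^ n / fact n) *\<^sub>R (L p ^^ n) (x0 p))
        \<le> (\<bar>t\<bar> ^ n / fact n) * ((c p0 + 1) ^ n * (norm (x0 p0) + 1))" .
  qed simp
  then show "isCont (\<lambda>p. lexp (L p) t (x0 p)) p0"
    using U by (simp add: continuous_on_eq_continuous_at)
qed

text \<open>Gronwall in energy form: by Cauchy-Schwarz the squared norm grows at rate at most
  \<open>2 * C\<close>, so damping it by \<open>exp (- 2 * C * s)\<close> gives a nonincreasing
  quantity that starts at 0.\<close>

lemma linear_ode_zero: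
  fixes D :: "real \<Rightarrow> 'a::real_inner"
  assumes ode: "\<And>t. 0 \<le> t \<Longrightarrow> (D has_vector_derivative L (D t)) (at t within {0..})"
    and L: "\<And>x. norm (L x) \<le> C * norm x" and D0: "D 0 = 0" and t: "0 \<le> t"
  shows "D t = 0"
proof -
  define u where "u s = exp (- 2 * C * s) * (D s \<bullet> D s)" for s
  have "u 0 \<ge> u t"
  \<comment> \<open>At 0 the derivative is one-sided, so the sign of the derivative is used on the
    open interval only, together with continuity on the closed one.\<close>
  proof (rule DERIV_nonpos_imp_decreasing_open[OF t])
    fix x :: real assume x: "0 < x" "x < t"
    then have "(D has_vector_derivative L (D x)) (at x)"
      using ode[of x] at_within_interior[of x "{0..}"] by simp
    then have D: "(D has_derivative (\<lambda>h. h *\<^sub>R L (D x))) (at x)"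
      by (simp add: has_vector_derivative_def)
    have "(u has_real_derivative exp (- 2 * C * x) * (2 * (D x \<bullet> L (D x) - C * (D x \<bullet> D x)))) (at x)"
      unfolding u_def has_field_derivative_def
      by (rule derivative_eq_intros D | simp)+ (simp add: fun_eq_iff algebra_simps inner_commute)
    moreover have "D x \<bullet> L (D x) \<le> C * (D x \<bullet> D x)"
    proof -
      have "D x \<bullet> L (D x) \<le> norm (D x) * norm (L (D x))"
        by (rule norm_cauchy_schwarz)
      also have "\<dots> \<le> norm (D x) * (C * norm (D x))"
        by (intro mult_left_mono L) simp
      also have "\<dots> = C * (D x \<bullet> D x)"
        by (simp add: power2_norm_eq_inner[symmetric] power2_eq_square)
      finally show ?thesis .
    qed
    ultimately show "\<exists>y. DERIV u x :> y \<and> y \<le> 0"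
      by (intro exI conjI) (auto simp: mult_le_0_iff)
  next
    have "continuous_on {0..} D"
      using ode by (auto simp: continuous_on_eq_continuous_within intro: has_vector_derivative_continuous)
    then have "continuous_on {0..t} D"
      by (rule continuous_on_subset) auto
    then show "continuous_on {0..t} u"
      unfolding u_def by (intro continuous_intros)
  qed
  then have "D t \<bullet> D t \<le> 0"
    by (simp add: u_def D0 mult_le_0_iff)
  then show ?thesis
    by (meson inner_gt_zero_iff not_less)
qed

lemma affine_ode_unique:
  fixes X Y :: "real \<Rightarrow> 'a::real_inner"
  assumes X: "\<And>t. 0 \<le> t \<Longrightarrow> (X has_vector_derivative (S + L (X t))) (at t within {0..})"
    and Y: "\<And>t. 0 \<le> t \<Longrightarrow> (Y has_vector_derivative (S + L (Y t))) (at t within {0..})"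
    and L: "linear L" "\<And>x. norm (L x) \<le> C * norm x" and init: "X 0 = Y 0" and t: "0 \<le> t"
  shows "X t = Y t"
proof -
  have "((\<lambda>t. X t - Y t) has_vector_derivative L (X t - Y t)) (at t within {0..})" if "0 \<le> t" for t
    using has_vector_derivative_diff[OF X[OF that] Y[OF that]] L(1) by (simp add: linear_diff)
  then have "(\<lambda>t. X t - Y t) t = 0"
    by (rule linear_ode_zero[where L=L, OF _ L(2)]) (use init t in auto)
  then show ?thesis by simp
qed

lemma bounded_bilinear_matrix_mult:
  "bounded_bilinear ((**) :: real^'n^'m \<Rightarrow> real^'p^'n \<Rightarrow> real^'p^'m)"
  unfolding bilinear_conv_bounded_bilinear[symmetric] bilinear_def
  by (intro conjI allI linearI)
     (simp_all add: vec_eq_iff matrix_matrix_mult_def sum.distrib distrib_left distrib_right,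
      simp_all add: sum_distrib_left mult_ac)

section \<open>The temporal-difference flow\<close>

lemmas matrix_mult_bilinear_simps =
  bounded_bilinear.add_left[OF bounded_bilinear_matrix_mult]
  bounded_bilinear.add_right[OF bounded_bilinear_matrix_mult]
  bounded_bilinear.diff_left[OF bounded_bilinear_matrix_mult]
  bounded_bilinear.diff_right[OF bounded_bilinear_matrix_mult]
  bounded_bilinear.minus_left[OF bounded_bilinear_matrix_mult]
  bounded_bilinear.minus_right[OF bounded_bilinear_matrix_mult]
  bounded_bilinear.scaleR_left[OF bounded_bilinear_matrix_mult]
  bounded_bilinear.scaleR_right[OF bounded_bilinear_matrix_mult]
  bounded_bilinear.zero_left[OF bounded_bilinear_matrix_mult]
  bounded_bilinear.zero_right[OF bounded_bilinear_matrix_mult]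

lemma norm_matrix_mult_le:
  obtains K where "0 < K" "\<And>(A :: real^'n^'m) (B :: real^'p^'n). norm (A ** B) \<le> norm A * norm B * K"
  using bounded_bilinear.pos_bounded[OF bounded_bilinear_matrix_mult] by blast

lemma norm_matrix_mult2_le:
  fixes A :: "real^'x^'x"
  obtains K where "0 \<le> K"
    "\<And>(X :: real^'k^'x) (W :: real^'k^'k). norm (A ** X ** W) \<le> K * norm W * norm X"
proof -
  obtain K1 where K1: "0 < K1" "\<And>(A :: real^'x^'x) (B :: real^'k^'x). norm (A ** B) \<le> norm A * norm B * K1"
    by (rule norm_matrix_mult_le) blast
  obtain K2 where K2: "0 < K2" "\<And>(A :: real^'k^'x) (B :: real^'k^'k). norm (A ** B) \<le> norm A * norm B * K2"
    by (rule norm_matrix_mult_le) blast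
  show thesis
  proof (rule that[of "norm A * K1 * K2"])
    fix X :: "real^'k^'x" and W :: "real^'k^'k"
    have "norm (A ** X ** W) \<le> norm (A ** X) * norm W * K2"
      by (rule K2)
    also have "\<dots> \<le> (norm A * norm X * K1) * norm W * K2"
      using K1 K2 by (intro mult_right_mono) auto
    finally show "norm (A ** X ** W) \<le> norm A * K1 * K2 * norm W * norm X"
      by (simp add: mult_ac)
  qed (use K1 K2 in auto)
qed

lemma matrix_mult_bound:
  fixes B :: "real^'n^'m"
  obtains C where "0 \<le> C" "\<And>X :: real^'p^'n. norm (B ** X) \<le> C * norm X"
  using bounded_linear.nonneg_bounded[OF bounded_bilinear.bounded_linear_right[OF bounded_bilinear_matrix_mult, of B]]
  by (metis mult.commute)

text \<open>The affine equation $X' = s - A X W$ is made linear by carrying the constant $s$ along as a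
  second component. The pair \<open>p\<close> is $(s, W)$.\<close>

definition td_flow ::
  "real^'x^'x \<Rightarrow> real \<Rightarrow> real^'k^'x \<Rightarrow> (real^'k^'x) \<times> (real^'k^'k) \<Rightarrow> real^'k^'x" where
  "td_flow A t \<Phi>0 p = fst (lexp (\<lambda>(X, s). (s - A ** X ** snd p, 0)) t (\<Phi>0, fst p))"

text \<open>The bound is affine in \<open>norm W\<close>: no constant works for all
  \<open>W\<close>, but this one is continuous in \<open>W\<close>, as
  \<open>continuous_on_lexp\<close> requires.\<close>

lemma td_generator_bound:
  fixes A :: "real^'x^'x"
  obtains K where "0 \<le> K"
    "\<And>(W :: real^'k^'k) (Y :: (real^'k^'x) \<times> (real^'k^'x)).
      norm (case Y of (X, s) \<Rightarrow> (s - A ** X ** W, 0 :: real^'k^'x)) \<le> (1 + K * norm W) * norm Y"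
proof -
  obtain K where K: "0 \<le> K"
    "\<And>(X :: real^'k^'x) (W :: real^'k^'k). norm (A ** X ** W) \<le> K * norm W * norm X"
    by (rule norm_matrix_mult2_le[of A]) blast
  show thesis
  proof (rule that[OF K(1)])
    fix W :: "real^'k^'k" and Y :: "(real^'k^'x) \<times> (real^'k^'x)"
    obtain X s where Y: "Y = (X, s)" by force
    have "norm (s - A ** X ** W) \<le> norm s + K * norm W * norm X"
      using norm_triangle_ineq4[of s "A ** X ** W"] K(2)[of X W] by linarith
    also have "\<dots> \<le> norm Y + K * norm W * norm Y"
      using norm_snd_le[of s X] norm_fst_le[of X s] K(1) unfolding Y
      by (intro add_mono mult_left_mono) auto
    finally show "norm (case Y of (X, s) \<Rightarrow> (s - A ** X ** W, 0 :: real^'k^'x)) \<le> (1 + K * norm W) * norm Y"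
      by (simp add: Y norm_Pair algebra_simps)
  qed
qed

lemma continuous_on_td_flow:
  fixes A :: "real^'x^'x" and \<Phi>0 :: "real^'k^'x"
  shows "continuous_on UNIV (td_flow A t \<Phi>0)"
proof -
  let ?L = "\<lambda>(p :: (real^'k^'x) \<times> (real^'k^'k)) (X :: real^'k^'x, s :: real^'k^'x).
    (s - A ** X ** snd p, 0 :: real^'k^'x)"
  obtain K where K: "0 \<le> K"
    "\<And>(W :: real^'k^'k) (Y :: (real^'k^'x) \<times> (real^'k^'x)).
      norm (case Y of (X, s) \<Rightarrow> (s - A ** X ** W, 0 :: real^'k^'x)) \<le> (1 + K * norm W) * norm Y"
    by (rule td_generator_bound[of A]) blast
  have "continuous_on UNIV (\<lambda>p :: (real^'k^'x) \<times> (real^'k^'k). lexp (?L p) t (\<Phi>0, fst p))"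
  proof (rule continuous_on_lexp)
    show "continuous_on UNIV (\<lambda>(p :: (real^'k^'x) \<times> (real^'k^'k), y). ?L p y)"
      unfolding split_beta'
      by (intro continuous_intros bounded_bilinear.continuous_on[OF bounded_bilinear_matrix_mult])
    show "norm (?L p y) \<le> (1 + K * norm (snd p)) * norm y" for p :: "(real^'k^'x) \<times> (real^'k^'k)" and y
      by (rule K)
  qed (use K(1) in \<open>auto intro!: continuous_intros\<close>)
  then show ?thesis
    unfolding td_flow_def by (intro continuous_on_fst)
qed

text \<open>Pairing the path with the constant \<open>S\<close> gives a solution of the linear
  system that defines \<open>td_flow\<close>, and such solutions are unique. A path known only
  through its equation thereby becomes an explicit function of \<open>(S, W)\<close>.\<close>

lemma td_flow_unique:
  fixes A :: "real^'x^'x" and \<Phi> :: "real \<Rightarrow> real^'k^'x"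
  assumes ode: "\<And>t. 0 \<le> t \<Longrightarrow>
      (\<Phi> has_vector_derivative (S - A ** \<Phi> t ** W)) (at t within {0..})"
    and t: "0 \<le> t"
  shows "\<Phi> t = td_flow A t (\<Phi> 0) (S, W)"
proof -
  let ?L = "\<lambda>(X :: real^'k^'x, s :: real^'k^'x). (s - A ** X ** W, 0 :: real^'k^'x)"
  let ?Y = "\<lambda>t. lexp ?L t (\<Phi> 0, S)"
  obtain K where K: "0 \<le> K"
    "\<And>(W :: real^'k^'k) (Y :: (real^'k^'x) \<times> (real^'k^'x)).
      norm (case Y of (X, s) \<Rightarrow> (s - A ** X ** W, 0 :: real^'k^'x)) \<le> (1 + K * norm W) * norm Y"
    by (rule td_generator_bound[of A]) blast
  have lin: "linear ?L"
    by (rule linearI) (auto simp: matrix_mult_bilinear_simps algebra_simps)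
  have "(\<Phi> t, S) = ?Y t"
  proof (rule affine_ode_unique[where S=0, OF _ _ lin K(2) _ t])
    fix t :: real assume "0 \<le> t"
    then show "((\<lambda>t. (\<Phi> t, S)) has_vector_derivative (0 + ?L (\<Phi> t, S))) (at t within {0..})"
      using has_vector_derivative_Pair[OF ode has_vector_derivative_const[of S]] by simp
    show "(?Y has_vector_derivative (0 + ?L (?Y t))) (at t within {0..})"
      using has_vector_derivative_at_within[OF lexp_has_vector_derivative[OF lin K(2)]] K(1) by simp
  qed simp
  then show ?thesis
    by (simp add: td_flow_def flip: \<open>(\<Phi> t, S) = ?Y t\<close>)
qed

text \<open>Each weight vector occurs both in the prediction and in the update direction, and the
  outer product of \<open>\<Phi> *v w\<close> with \<open>w\<close> is
  \<open>\<Phi> ** outer w w\<close>. Hence the drift sees the sample only through the two sums on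
  the right.\<close>

lemma td_sum_eq:
  fixes P :: "real^'x^'x" and \<Phi> :: "real^'k^'x"
  shows "(\<Sum>m<M. outer (rs m + \<gamma> *\<^sub>R (P *v (\<Phi> *v ws m)) - \<Phi> *v ws m) (ws m)) =
    (\<Sum>m<M. outer (rs m) (ws m)) - (mat 1 - \<gamma> *\<^sub>R P) ** \<Phi> ** (\<Sum>m<M. outer (ws m) (ws m))"
proof -
  have mv: "(A ** \<Phi>) *v w = A *v (\<Phi> *v w)" for A :: "real^'x^'x" and w
    by (simp add: matrix_vector_mul_assoc)
  have outer_diff: "outer (a - b) w = outer a w - outer b w" for a b :: "real^'x" and w :: "real^'k"
    by (simp add: outer_def vec_eq_iff left_diff_distrib)
  have outer_mv: "outer (B *v w) w = B ** outer w w" for B :: "real^'k^'x" and w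
    by (simp add: outer_def vec_eq_iff matrix_matrix_mult_def matrix_vector_mult_def sum_distrib_right mult.assoc)
  have "outer (r + \<gamma> *\<^sub>R (P *v (\<Phi> *v w)) - \<Phi> *v w) w
      = outer r w - (mat 1 - \<gamma> *\<^sub>R P) ** \<Phi> ** outer w w" for r w
  proof -
    have "r + \<gamma> *\<^sub>R (P *v (\<Phi> *v w)) - \<Phi> *v w = r - ((mat 1 - \<gamma> *\<^sub>R P) ** \<Phi>) *v w"
      unfolding mv by (simp add: matrix_vector_mult_diff_rdistrib scaleR_matrix_vector_assoc)
    then show ?thesis by (simp only: outer_diff outer_mv)
  qed
  then show ?thesis
    by (simp add: sum_subtractf bounded_bilinear.sum_right[OF bounded_bilinear_matrix_mult])
qed

section \<open>The matrix exponential, its decay, and the discounted resolvent\<close>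

lemma mexp_eq_lexp: "mexp (t *\<^sub>R B) = lexp (\<lambda>X. B ** X) t (mat 1)"
proof -
  have "mpow (t *\<^sub>R B) n = t ^ n *\<^sub>R ((\<lambda>X. B ** X) ^^ n) (mat 1)" for n
    by (induction n) (simp_all add: matrix_mult_bilinear_simps)
  then show ?thesis by (simp add: mexp_def lexp_def)
qed

lemma mexp_0: "mexp (0 *\<^sub>R B) = mat 1"
  by (simp only: mexp_eq_lexp lexp_0)

lemma linear_matrix_mult: "linear (\<lambda>X :: real^'k^'x. (B :: real^'x^'x) ** X)"
  by (rule linearI) (simp_all add: matrix_mult_bilinear_simps)

lemma mexp_has_vector_derivative:
  fixes B :: "real^'x^'x"
  shows "((\<lambda>t. mexp (t *\<^sub>R B)) has_vector_derivative B ** mexp (t *\<^sub>R B)) (at t)"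
proof -
  obtain K where K: "0 \<le> K" "\<And>X :: real^'x^'x. norm (B ** X) \<le> K * norm X"
    by (rule matrix_mult_bound[of B]) blast
  then show ?thesis
    unfolding mexp_eq_lexp
    by (intro lexp_has_vector_derivative[where C=K] linear_matrix_mult)
qed

text \<open>Identities for \<open>mexp\<close> can now be checked by differentiating a candidate
  instead of rearranging series.\<close>

lemma mexp_unique:
  fixes Y :: "real \<Rightarrow> real^'x^'x"
  assumes ode: "\<And>t. 0 \<le> t \<Longrightarrow> (Y has_vector_derivative B ** Y t) (at t within {0..})"
    and "Y 0 = mat 1" "0 \<le> t"
  shows "Y t = mexp (t *\<^sub>R B)"
proof -
  obtain K where K: "0 \<le> K" "\<And>X :: real^'x^'x. norm (B ** X) \<le> K * norm X"
    by (rule matrix_mult_bound[of B]) blast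
  show ?thesis
  proof (rule affine_ode_unique[where S=0, OF _ _ linear_matrix_mult K(2)])
    show "(Y has_vector_derivative 0 + B ** Y t) (at t within {0..})" if "0 \<le> t" for t
      using ode[OF that] by simp
    show "((\<lambda>t. mexp (t *\<^sub>R B)) has_vector_derivative 0 + B ** mexp (t *\<^sub>R B)) (at t within {0..})" for t
      using has_vector_derivative_at_within[OF mexp_has_vector_derivative] by simp
    show "Y 0 = mexp (0 *\<^sub>R B)"
      by (simp only: assms mexp_0)
  qed fact
qed

text \<open>For identity weights the equation is X' = Z - A X. Its stationary point is
  \<open>A' ** Z\<close>, and the deviation from it decays by the homogeneous flow.\<close>

lemma td_flow_identity:
  fixes A :: "real^'x^'x" and \<Phi>0 Z :: "real^'k^'x"
  assumes inv: "A ** A' = mat 1" and t: "0 \<le> t"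
  shows "td_flow A t \<Phi>0 (Z, mat 1) = mexp (- t *\<^sub>R A) ** (\<Phi>0 - A' ** Z) + A' ** Z"
proof -
  let ?F = "\<lambda>t. mexp (t *\<^sub>R (- A)) ** (\<Phi>0 - A' ** Z) + A' ** Z"
  \<comment> \<open>The initial value is left as \<open>?F 0\<close> to match the uniqueness lemma;
    \<open>mexp_0\<close> reduces it to \<open>\<Phi>0\<close> at the end.\<close>
  have "td_flow A t (?F 0) (Z, mat 1) = ?F t"
  proof (rule td_flow_unique[symmetric, OF _ t])
    fix t :: real assume "0 \<le> t"
    have "(?F has_vector_derivative (- A ** mexp (t *\<^sub>R (- A))) ** (\<Phi>0 - A' ** Z) + 0) (at t within {0..})"
      by (intro has_vector_derivative_add has_vector_derivative_const
          bounded_linear.has_vector_derivative[OF bounded_bilinear.bounded_linear_left[OF bounded_bilinear_matrix_mult]]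
          has_vector_derivative_at_within[OF mexp_has_vector_derivative])
    moreover have "A ** (A' ** Z) = Z"
      by (simp add: matrix_mul_assoc inv)
    ultimately show "(?F has_vector_derivative (Z - A ** ?F t ** mat 1)) (at t within {0..})"
      by (simp add: matrix_mult_bilinear_simps matrix_mul_assoc)
  qed
  then show ?thesis
    by (simp only: mexp_0) simp
qed

text \<open>The identity matrix commutes with \<open>P\<close>, so its exponential splits off as a
  scalar; both sides solve the same initial value problem.\<close>

lemma mexp_scaled_identity:
  fixes P :: "real^'x^'x"
  assumes "0 \<le> t"
  shows "mexp (- t *\<^sub>R (mat 1 - \<gamma> *\<^sub>R P)) = exp (- t) *\<^sub>R mexp (t *\<^sub>R (\<gamma> *\<^sub>R P))"
proof -
  have "exp (- t) *\<^sub>R mexp (t *\<^sub>R (\<gamma> *\<^sub>R P)) = mexp (t *\<^sub>R (- (mat 1 - \<gamma> *\<^sub>R P)))"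
  proof (rule mexp_unique[OF _ _ assms])
    fix t :: real
    have "((\<lambda>t. exp (- t) *\<^sub>R mexp (t *\<^sub>R (\<gamma> *\<^sub>R P))) has_vector_derivative
        exp (- t) *\<^sub>R ((\<gamma> *\<^sub>R P) ** mexp (t *\<^sub>R (\<gamma> *\<^sub>R P))) + (- exp (- t)) *\<^sub>R mexp (t *\<^sub>R (\<gamma> *\<^sub>R P)))
        (at t within {0..})"
      by (rule has_vector_derivative_scaleR[OF _ has_vector_derivative_at_within[OF mexp_has_vector_derivative]])
         (auto intro!: derivative_eq_intros)
    then show "((\<lambda>t. exp (- t) *\<^sub>R mexp (t *\<^sub>R (\<gamma> *\<^sub>R P))) has_vector_derivative
        - (mat 1 - \<gamma> *\<^sub>R P) ** (exp (- t) *\<^sub>R mexp (t *\<^sub>R (\<gamma> *\<^sub>R P)))) (at t within {0..})"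
      by (simp add: matrix_mult_bilinear_simps algebra_simps)
  qed (simp only: mexp_0, simp)
  then show ?thesis
    by (simp only: scaleR_minus_left scaleR_minus_right)
qed

text \<open>A row of \<open>P\<close> averages, and an average does not exceed the largest value, so
  by induction the n-th power of \<open>\<gamma> *\<^sub>R P\<close> has entries between 0 and
  \<open>\<gamma> ^ n\<close>. The series is then dominated by that of the scalar
  exponential.\<close>

lemma mexp_stochastic_bound:
  fixes P :: "real^'x^'x"
  assumes P: "row_stochastic P" and \<gamma>: "0 \<le> \<gamma>" and t: "0 \<le> t"
  shows "\<bar>mexp (t *\<^sub>R (\<gamma> *\<^sub>R P)) $ i $ j\<bar> \<le> exp (t * \<gamma>)"
proof -
  let ?T = "\<lambda>n. ((\<lambda>X. (\<gamma> *\<^sub>R P) ** X) ^^ n) (mat 1)"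
  have entry: "0 \<le> ?T n $ i $ j \<and> ?T n $ i $ j \<le> \<gamma> ^ n" for n i j
  proof (induction n arbitrary: i j)
    case (Suc n)
    have eq: "?T (Suc n) $ i $ j = \<gamma> * (\<Sum>l\<in>UNIV. P $ i $ l * ?T n $ l $ j)"
      by (simp add: matrix_matrix_mult_def sum_distrib_left mult.assoc)
    have "(\<Sum>l\<in>UNIV. P $ i $ l * ?T n $ l $ j) \<le> (\<Sum>l\<in>UNIV. P $ i $ l * \<gamma> ^ n)"
      using P Suc.IH by (intro sum_mono mult_left_mono) (auto simp: row_stochastic_def)
    also have "\<dots> = \<gamma> ^ n"
      using P by (simp add: row_stochastic_def flip: sum_distrib_right)
    finally have "(\<Sum>l\<in>UNIV. P $ i $ l * ?T n $ l $ j) \<le> \<gamma> ^ n" .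
    moreover have "0 \<le> (\<Sum>l\<in>UNIV. P $ i $ l * ?T n $ l $ j)"
      using P Suc.IH by (intro sum_nonneg mult_nonneg_nonneg) (auto simp: row_stochastic_def)
    ultimately show ?case
      unfolding eq using \<gamma> by (auto intro: mult_left_mono)
  qed (auto simp: mat_def)
  obtain K where K: "0 \<le> K" "\<And>X :: real^'x^'x. norm ((\<gamma> *\<^sub>R P) ** X) \<le> K * norm X"
    by (rule matrix_mult_bound[of "\<gamma> *\<^sub>R P"]) blast
  have "(\<lambda>n. (t ^ n / fact n) *\<^sub>R ?T n) sums mexp (t *\<^sub>R (\<gamma> *\<^sub>R P))"
    unfolding mexp_eq_lexp lexp_def
    by (rule summable_sums[OF summable_lexp[OF K(2,1)]])
  then have "(\<lambda>n. ((t ^ n / fact n) *\<^sub>R ?T n) $ i $ j) sums (mexp (t *\<^sub>R (\<gamma> *\<^sub>R P)) $ i $ j)"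
    by (intro bounded_linear.sums[OF bounded_linear_vec_nth])
  then have sums: "(\<lambda>n. (t ^ n / fact n) * ?T n $ i $ j) sums (mexp (t *\<^sub>R (\<gamma> *\<^sub>R P)) $ i $ j)"
    by simp
  have "(\<lambda>n. (t * \<gamma>) ^ n /\<^sub>R fact n) sums exp (t * \<gamma>)"
    by (rule exp_converges)
  then have sums': "(\<lambda>n. (t ^ n / fact n) * \<gamma> ^ n) sums exp (t * \<gamma>)"
    by (simp add: power_mult_distrib field_simps)
  have "mexp (t *\<^sub>R (\<gamma> *\<^sub>R P)) $ i $ j \<le> exp (t * \<gamma>)"
    using entry t by (intro sums_le[OF _ sums sums'] mult_left_mono) auto
  moreover have "0 \<le> mexp (t *\<^sub>R (\<gamma> *\<^sub>R P)) $ i $ j"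
    by (rule sums_le[OF _ sums_zero sums]) (use entry t in \<open>auto intro!: mult_nonneg_nonneg\<close>)
  ultimately show ?thesis by simp
qed

text \<open>The decay \<open>exp (- t)\<close> from the identity beats the growth
  \<open>exp (t * \<gamma>)\<close> allowed by \<open>P\<close>; the gap \<open>1 - \<gamma>\<close>
  is the rate.\<close>

lemma mexp_tendsto_0:
  fixes P :: "real^'x^'x"
  assumes P: "row_stochastic P" and \<gamma>: "0 \<le> \<gamma>" "\<gamma> < 1"
  shows "((\<lambda>t. mexp (- t *\<^sub>R (mat 1 - \<gamma> *\<^sub>R P))) \<longlongrightarrow> 0) at_top"
proof (intro vec_tendstoI)
  fix i j
  have "((\<lambda>t. exp (- t * (1 - \<gamma>))) \<longlongrightarrow> 0) at_top"
    using \<gamma> by real_asymp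
  then have "((\<lambda>t. mexp (- t *\<^sub>R (mat 1 - \<gamma> *\<^sub>R P)) $ i $ j) \<longlongrightarrow> 0) at_top"
  proof (rule Lim_null_comparison[rotated])
    show "\<forall>\<^sub>F t in at_top. norm (mexp (- t *\<^sub>R (mat 1 - \<gamma> *\<^sub>R P)) $ i $ j) \<le> exp (- t * (1 - \<gamma>))"
      using eventually_ge_at_top[of 0]
    proof eventually_elim
      case (elim t)
      have "norm (mexp (- t *\<^sub>R (mat 1 - \<gamma> *\<^sub>R P)) $ i $ j) = exp (- t) * \<bar>mexp (t *\<^sub>R (\<gamma> *\<^sub>R P)) $ i $ j\<bar>"
        by (simp add: mexp_scaled_identity[OF elim] abs_mult del: scaleR_scaleR scaleR_minus_left)
      also have "\<dots> \<le> exp (- t) * exp (t * \<gamma>)"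
        by (intro mult_left_mono mexp_stochastic_bound P \<gamma> elim) simp
      also have "\<dots> = exp (- t * (1 - \<gamma>))"
        by (simp add: algebra_simps flip: exp_add)
      finally show ?case .
    qed
  qed
  then show "((\<lambda>t. mexp (- t *\<^sub>R (mat 1 - \<gamma> *\<^sub>R P)) $ i $ j) \<longlongrightarrow> 0 $ i $ j) at_top"
    by simp
qed

text \<open>\<open>matrix_inv\<close> is a choice that means something only for invertible matrices.
  For a square matrix a trivial kernel suffices, and a kernel vector satisfies v = \<gamma> P v,
  which contracts its maximum norm.\<close>

lemma matrix_inv_discounted:
  fixes P :: "real^'x^'x"
  assumes P: "row_stochastic P" and \<gamma>: "0 \<le> \<gamma>" "\<gamma> < 1"
  shows "(mat 1 - \<gamma> *\<^sub>R P) ** matrix_inv (mat 1 - \<gamma> *\<^sub>R P) = mat 1"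
proof -
  have "v = 0" if "(mat 1 - \<gamma> *\<^sub>R P) *v v = 0" for v
  proof -
    have v: "v = \<gamma> *\<^sub>R (P *v v)"
      using that by (simp add: matrix_vector_mult_diff_rdistrib scaleR_matrix_vector_assoc)
    \<comment> \<open>The maximum norm of \<open>v\<close>, attained at some coordinate
      \<open>i\<close>; comparing both sides of \<open>v\<close> there yields m \<le> \<gamma>
      m.\<close>
    define m where "m = Max (range (\<lambda>i. \<bar>v $ i\<bar>))"
    have le_m: "\<bar>v $ i\<bar> \<le> m" for i
      by (simp add: m_def)
    have "m \<in> range (\<lambda>i. \<bar>v $ i\<bar>)"
      unfolding m_def by (intro Max_in) auto
    then obtain i where i: "m = \<bar>v $ i\<bar>"
      by blast
    have vi: "v $ i = \<gamma> * (\<Sum>j\<in>UNIV. P $ i $ j * v $ j)"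
      using arg_cong[OF v, of "\<lambda>u. u $ i"] by (simp add: matrix_vector_mult_def)
    have "m = \<gamma> * \<bar>\<Sum>j\<in>UNIV. P $ i $ j * v $ j\<bar>"
      unfolding i vi using \<gamma> by (simp add: abs_mult)
    also have "\<dots> \<le> \<gamma> * (\<Sum>j\<in>UNIV. P $ i $ j * m)"
      using P \<gamma> le_m
      by (intro mult_left_mono order_trans[OF sum_abs] sum_mono)
         (auto simp: abs_mult row_stochastic_def intro!: mult_left_mono)
    also have "\<dots> = \<gamma> * m"
      using P by (simp add: row_stochastic_def flip: sum_distrib_right)
    finally have "(1 - \<gamma>) * m \<le> 0"
      by (simp add: algebra_simps)
    then have "m \<le> 0"
      using \<gamma> by (simp add: mult_le_0_iff)
    then show ?thesis
      using le_m by (metis abs_le_zero_iff order_trans vec_eq_iff zero_index)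
  qed
  then have "invertible (mat 1 - \<gamma> *\<^sub>R P)"
    by (simp add: invertible_left_inverse matrix_left_invertible_ker)
  then show ?thesis
    unfolding invertible_def matrix_inv_def by (rule someI2_ex) simp
qed

section \<open>Joint limit of the weighted sums\<close>

text \<open>Polarization: mixed second moments are recovered from the variances of all
  one-dimensional projections.\<close>

lemma polarized_moments:
  fixes N :: "'a::real_inner measure"
  assumes "\<And>\<theta>. integrable N (\<lambda>x. (\<theta> \<bullet> x)\<^sup>2)" "\<And>\<theta>. (\<integral>x. (\<theta> \<bullet> x)\<^sup>2 \<partial>N) = q \<theta>"
  shows "integrable N (\<lambda>x. (a \<bullet> x) * (b \<bullet> x))"
    "(\<integral>x. (a \<bullet> x) * (b \<bullet> x) \<partial>N) = (q (a + b) - q a - q b) / 2"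
proof -
  have eq: "(a \<bullet> x) * (b \<bullet> x) = (((a + b) \<bullet> x)\<^sup>2 - (a \<bullet> x)\<^sup>2 - (b \<bullet> x)\<^sup>2) / 2" for x
    by (simp add: inner_add_left power2_eq_square algebra_simps)
  show "integrable N (\<lambda>x. (a \<bullet> x) * (b \<bullet> x))"
    unfolding eq by (intro Bochner_Integration.integrable_diff integrable_divide assms)
  show "(\<integral>x. (a \<bullet> x) * (b \<bullet> x) \<partial>N) = (q (a + b) - q a - q b) / 2"
    unfolding eq by (simp add: assms)
qed

lemma prod_Basis_vec: "(\<Prod>b\<in>Basis. f b) = (\<Prod>k\<in>UNIV. f (axis k 1 :: real^'n))"
proof -
  have "(Basis :: (real^'n) set) = range (\<lambda>k. axis k 1)"
    by (auto simp: Basis_vec_def)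
  moreover have "inj (\<lambda>k. axis k 1 :: real^'n)"
    by (auto intro!: injI simp: axis_eq_axis)
  ultimately show ?thesis
    by (metis (no_types, lifting) prod.reindex_cong)
qed

text \<open>This removes \<open>M\<close> from the measure: the weights become rescaled copies of
  one Gaussian, and \<open>M\<close> survives only in the integrand, where limits can be
  taken.\<close>

lemma weight_law_eq:
  assumes M: "0 < M"
  shows "(weight_law M :: (real^'k) measure) = distr std_gaussian borel (\<lambda>g. (1 / sqrt (real M)) *\<^sub>R g)"
proof -
  define \<sigma> where "\<sigma> = 1 / sqrt (real M)"
  have \<sigma>: "0 < \<sigma>" using M by (simp add: \<sigma>_def)
  let ?p = "\<lambda>w :: real^'k. \<Prod>k\<in>UNIV. ennreal (normal_density 0 \<sigma> (w $ k))"
  let ?T = "\<lambda>g :: real^'k. \<sigma> *\<^sub>R g"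
  \<comment> \<open>The Jacobian \<open>\<sigma> ^ CARD('k)\<close> supplies one factor
    \<open>\<sigma>\<close> per coordinate, just what each rescaled normal density lacks.\<close>
  have p: "ennreal (\<sigma> ^ CARD('k)) * ?p (?T x) = ennreal (\<Prod>b\<in>Basis. std_normal_density (x \<bullet> b))" for x
  proof -
    have nd: "\<sigma> * normal_density 0 \<sigma> (\<sigma> * y) = std_normal_density y" for y
      using \<sigma> by (simp add: normal_density_def real_sqrt_mult power_mult_distrib)
    have "ennreal (\<sigma> ^ CARD('k)) * ?p (?T x) = ennreal (\<sigma> ^ CARD('k) * (\<Prod>k\<in>UNIV. normal_density 0 \<sigma> (\<sigma> * x $ k)))"
      using \<sigma> by (subst ennreal_mult) (auto simp: prod_ennreal prod_nonneg)
    also have "\<sigma> ^ CARD('k) * (\<Prod>k\<in>UNIV. normal_density 0 \<sigma> (\<sigma> * x $ k)) = (\<Prod>k\<in>UNIV. std_normal_density (x $ k))"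
      by (simp add: nd flip: prod_constant prod.distrib)
    also have "\<dots> = (\<Prod>b\<in>Basis. std_normal_density (x \<bullet> b))"
      by (simp add: prod_Basis_vec cart_eq_inner_axis)
    finally show ?thesis .
  qed
  have [measurable]: "?p \<in> borel_measurable borel"
    by measurable
  have "weight_law M = density lborel ?p"
    by (simp add: weight_law_def \<sigma>_def)
  also have "\<dots> = density (density (distr lborel borel ?T) (\<lambda>_. ennreal (\<sigma> ^ CARD('k)))) ?p"
    using lborel_affine[of \<sigma> "0 :: real^'k"] \<sigma> by (simp add: ennreal_power)
  also have "\<dots> = density (distr lborel borel ?T) (\<lambda>x. ennreal (\<sigma> ^ CARD('k)) * ?p x)"
    by (subst density_density_eq) auto
  also have "\<dots> = distr (density lborel (\<lambda>x. ennreal (\<sigma> ^ CARD('k)) * ?p (?T x))) borel ?T"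
    by (rule density_distr) auto
  also have "\<dots> = distr std_gaussian borel ?T"
    unfolding p std_gaussian_def ..
  finally show ?thesis by (simp add: \<sigma>_def)
qed

lemma sets_weight_law [simp, measurable_cong]: "sets (weight_law M) = sets borel"
  by (simp add: weight_law_def)

lemma prob_space_weight_law: "0 < M \<Longrightarrow> prob_space (weight_law M)"
  unfolding weight_law_eq
  by (intro prob_space.prob_space_distr prob_space_std_gaussian) auto

text \<open>For fixed \<open>r\<close> the pairing is linear in \<open>g\<close>, so the Gaussian
  moment formulas apply conditionally on the reward.\<close>

lemma inner_outer: "\<Theta> \<bullet> outer r g = (transpose \<Theta> *v r) \<bullet> g"
proof -
  have "\<Theta> \<bullet> outer r g = (\<Sum>i\<in>UNIV. \<Sum>j\<in>UNIV. \<Theta> $ i $ j * r $ i * g $ j)"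
    by (simp add: inner_vec_def outer_def mult.assoc)
  also have "\<dots> = (transpose \<Theta> *v r) \<bullet> g"
    by (subst sum.swap)
       (simp add: inner_vec_def matrix_vector_mult_def transpose_def sum_distrib_right)
  finally show ?thesis .
qed

lemma measurable_outer [measurable (raw)]:
  assumes "f \<in> borel_measurable M" "g \<in> borel_measurable M"
  shows "(\<lambda>x. outer (f x :: real^'x) (g x :: real^'k)) \<in> borel_measurable M"
proof -
  have "continuous_on UNIV (\<lambda>(u :: real^'x, v :: real^'k). outer u v)"
    unfolding split_beta' outer_def by (intro continuous_intros)
  then have "(\<lambda>x. case (f x, g x) of (u, v) \<Rightarrow> outer u v) \<in> borel_measurable M"
    by (rule borel_measurable_continuous_on) (intro borel_measurable_Pair assms)
  then show ?thesis by simp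
qed

text \<open>To be used with x of order 1 / sqrt M and y of order 1 / M. The first bound, multiplied
  by M, stays bounded in M and serves as a majorant; the second, multiplied by M, tends to 0 and
  gives the pointwise limit. Both come from expanding the two factors of cis x * cis y
  separately.\<close>

lemma cis_expansion:
  fixes x y :: real
  shows "cmod (cis (x + y) - 1 - \<i> * of_real x) \<le> x\<^sup>2 / 2 + \<bar>y\<bar>" (is ?first)
    and "cmod (cis (x + y) - 1 - \<i> * of_real x - (- (of_real x)\<^sup>2 / 2 + \<i> * of_real y))
      \<le> y\<^sup>2 / 2 + \<bar>x\<bar> * \<bar>y\<bar> + \<bar>x\<bar> ^ 3 / 6" (is ?second)
proof -
  have e0: "cmod (cis u - 1) \<le> \<bar>u\<bar>" for u
    using iexp_approx1[of u 0] by (simp add: cis_conv_exp)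
  have e1: "cmod (cis u - 1 - \<i> * of_real u) \<le> u\<^sup>2 / 2" for u
    using iexp_approx1[of u 1] by (simp add: cis_conv_exp diff_diff_eq power2_eq_square)
  have e2: "cmod (cis u - 1 - \<i> * of_real u + (of_real u)\<^sup>2 / 2) \<le> \<bar>u\<bar> ^ 3 / 6" for u
    using iexp_approx1[of u 2]
    by (simp add: cis_conv_exp eval_nat_numeral algebra_simps)
  define A where "A = cis x * (cis y - 1)"
  define A' where "A' = cis x * (cis y - 1 - \<i> * of_real y)"
  define B where "B = cis x - 1 - \<i> * of_real x"
  define B' where "B' = cis x - 1 - \<i> * of_real x + (of_real x)\<^sup>2 / 2"
  define C where "C = (cis x - 1) * (\<i> * of_real y)"
  have nA: "cmod A = cmod (cis y - 1)" and nA': "cmod A' = cmod (cis y - 1 - \<i> * of_real y)"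
    by (simp_all add: A_def A'_def norm_mult)
  have nC: "cmod C \<le> \<bar>x\<bar> * \<bar>y\<bar>"
    using e0[of x] by (simp add: C_def norm_mult mult_right_mono)
  have "cis (x + y) - 1 - \<i> * of_real x = A + B"
    by (simp add: A_def B_def algebra_simps flip: cis_mult)
  then have "cmod (cis (x + y) - 1 - \<i> * of_real x) \<le> cmod A + cmod B"
    by (simp only: norm_triangle_ineq)
  then show ?first
    using e0[of y] e1[of x, folded B_def] unfolding nA by linarith
  have "cis (x + y) - 1 - \<i> * of_real x - (- (of_real x)\<^sup>2 / 2 + \<i> * of_real y) = A' + C + B'"
    by (simp add: A'_def B'_def C_def algebra_simps flip: cis_mult)
  then have "cmod (cis (x + y) - 1 - \<i> * of_real x - (- (of_real x)\<^sup>2 / 2 + \<i> * of_real y))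
      \<le> cmod (A' + C) + cmod B'"
    by (simp only: norm_triangle_ineq)
  then show ?second
    using norm_triangle_ineq[of A' C] nC e1[of y] e2[of x, folded B'_def] unfolding nA' by linarith
qed

lemma cis_scaled_limit:
  fixes a b :: real
  shows "(\<lambda>M. of_nat M * (cis (a / sqrt (real M) + b / real M) - 1 - \<i> * of_real (a / sqrt (real M))))
    \<longlonglongrightarrow> - (of_real a)\<^sup>2 / 2 + \<i> * of_real b"
proof (rule LIM_zero_cancel, rule Lim_null_comparison)
  \<comment> \<open>This is M times the second bound of \<open>cis_expansion\<close> at x = a / sqrt
    M and y = b / M.\<close>
  show "(\<lambda>M. b\<^sup>2 / (2 * real M) + \<bar>a\<bar> * \<bar>b\<bar> / sqrt (real M) + \<bar>a\<bar> ^ 3 / (6 * sqrt (real M))) \<longlonglongrightarrow> 0"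
    by real_asymp
  show "\<forall>\<^sub>F M in sequentially.
      cmod (of_nat M * (cis (a / sqrt (real M) + b / real M) - 1 - \<i> * of_real (a / sqrt (real M)))
        - (- (of_real a)\<^sup>2 / 2 + \<i> * of_real b))
      \<le> b\<^sup>2 / (2 * real M) + \<bar>a\<bar> * \<bar>b\<bar> / sqrt (real M) + \<bar>a\<bar> ^ 3 / (6 * sqrt (real M))"
    using eventually_gt_at_top[of 0]
  proof eventually_elim
    case (elim M)
    define s where "s = sqrt (real M)"
    have s: "0 < s" "real M = s * s" using elim by (simp_all add: s_def)
    define x where "x = a / s"
    define y where "y = b / real M"
    have xy: "complex_of_real a = of_real s * of_real x" "complex_of_real b = of_real (s * s) * of_real y"
      using s by (simp_all add: x_def y_def)
    have M: "(of_nat M :: complex) = of_real (s * s)"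
      by (metis s(2) of_real_of_nat_eq)
    have "of_nat M * (cis (x + y) - 1 - \<i> * of_real x) - (- (of_real a)\<^sup>2 / 2 + \<i> * of_real b) =
        of_nat M * (cis (x + y) - 1 - \<i> * of_real x - (- (of_real x)\<^sup>2 / 2 + \<i> * of_real y))"
      unfolding xy M by (simp add: algebra_simps power2_eq_square)
    then have "cmod (of_nat M * (cis (x + y) - 1 - \<i> * of_real x) - (- (of_real a)\<^sup>2 / 2 + \<i> * of_real b)) =
        real M * cmod (cis (x + y) - 1 - \<i> * of_real x - (- (of_real x)\<^sup>2 / 2 + \<i> * of_real y))"
      by (simp only: norm_mult norm_of_nat)
    also have "\<dots> \<le> real M * (y\<^sup>2 / 2 + \<bar>x\<bar> * \<bar>y\<bar> + \<bar>x\<bar> ^ 3 / 6)"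
      by (intro mult_left_mono cis_expansion(2)) simp
    also have "\<dots> = b\<^sup>2 / (2 * real M) + \<bar>a\<bar> * \<bar>b\<bar> / s + \<bar>a\<bar> ^ 3 / (6 * s)"
      unfolding x_def y_def s(2) using s(1)
      by (simp add: field_simps power2_eq_square power3_eq_cube)
    finally show ?case by (simp add: x_def y_def s_def)
  qed
qed

text \<open>Both \<open>h n\<close> and \<open>exp (c / of_nat n)\<close> lie in the closed unit
  disc, the latter because \<open>Re c \<le> 0\<close>, so their n-th powers differ by at most n
  times their distance. That product vanishes since both, less 1 and times n, tend to
  \<open>c\<close>. No complex logarithm is involved.\<close>

lemma power_limit_exp:
  fixes h :: "nat \<Rightarrow> complex"
  assumes h: "\<And>n. cmod (h n) \<le> 1" and lim: "(\<lambda>n. of_nat n * (h n - 1)) \<longlonglongrightarrow> c" and c: "Re c \<le> 0"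
  shows "(\<lambda>n. h n ^ n) \<longlonglongrightarrow> exp c"
proof (rule LIM_zero_cancel, rule Lim_null_comparison)
  have "(\<lambda>n. of_nat n * (exp (c / of_nat n) - 1)) \<longlonglongrightarrow> c"
  proof (cases "c = 0")
    case False
    have "(exp has_field_derivative 1) (at (0::complex))"
      using DERIV_exp[of 0] by simp
    then have "((\<lambda>z. (exp z - 1) / z) \<longlongrightarrow> 1) (at (0::complex))"
      by (simp add: has_field_derivative_iff)
    moreover have "filterlim (\<lambda>n. c / of_nat n) (at 0) sequentially"
    proof (rule filterlim_atI)
      show "(\<lambda>n. c / of_nat n) \<longlonglongrightarrow> 0"
        by (rule tendsto_divide_0[OF tendsto_const tendsto_of_nat])
      show "\<forall>\<^sub>F n in sequentially. c / of_nat n \<noteq> 0"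
        using eventually_gt_at_top[of 0] by eventually_elim (simp add: False)
    qed
    ultimately have "(\<lambda>n. (exp (c / of_nat n) - 1) / (c / of_nat n)) \<longlonglongrightarrow> 1"
      by (rule filterlim_compose)
    then have "(\<lambda>n. c * ((exp (c / of_nat n) - 1) / (c / of_nat n))) \<longlonglongrightarrow> c * 1"
      by (intro tendsto_intros)
    moreover have "c * ((exp (c / of_nat n) - 1) / (c / of_nat n)) = of_nat n * (exp (c / of_nat n) - 1)" for n
      using False by simp
    ultimately show ?thesis by simp
  qed simp
  from tendsto_diff[OF lim this]
  have "(\<lambda>n. of_nat n * (h n - exp (c / of_nat n))) \<longlonglongrightarrow> 0"
    by (simp add: algebra_simps)
  then show "(\<lambda>n. cmod (of_nat n * (h n - exp (c / of_nat n)))) \<longlonglongrightarrow> 0"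
    by (rule tendsto_norm_zero)
  show "\<forall>\<^sub>F n in sequentially. cmod (h n ^ n - exp c) \<le> cmod (of_nat n * (h n - exp (c / of_nat n)))"
    using eventually_gt_at_top[of 0]
  proof eventually_elim
    case (elim n)
    have "exp (c / of_nat n) ^ n = exp c"
      using elim by (simp flip: exp_of_nat_mult)
    moreover have "cmod (exp (c / of_nat n)) \<le> 1"
      using c by (simp add: divide_nonpos_nonneg)
    ultimately show ?case
      using norm_power_diff[OF h, of "exp (c / of_nat n)" n n] by (simp add: norm_mult)
  qed
qed

text \<open>The matrix of second moments of \<open>g\<close> is the identity, and
  \<open>\<Xi> \<bullet> mat 1\<close> is the trace of \<open>\<Xi>\<close>. This is where the limit
  of the sum of \<open>outer (ws m) (ws m)\<close> comes from.\<close>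

lemma std_gaussian_quadratic:
  fixes \<Xi> :: "real^'k^'k"
  shows "integrable std_gaussian (\<lambda>g. \<Xi> \<bullet> outer g g)" "(\<integral>g. \<Xi> \<bullet> outer g g \<partial>std_gaussian) = \<Xi> \<bullet> mat 1"
proof -
  have eq: "\<Xi> \<bullet> outer g g = (\<Sum>i\<in>UNIV. \<Sum>j\<in>UNIV. \<Xi> $ i $ j * ((axis i 1 \<bullet> g) * (axis j 1 \<bullet> g)))" for g
    by (simp add: inner_vec_def[of \<Xi>] inner_vec_def[of "\<Xi> $ i" for i] outer_def inner_axis inner_commute[of "axis i 1" for i])
  note pm = polarized_moments[where N=std_gaussian and q="\<lambda>\<theta>. \<theta> \<bullet> \<theta>", OF std_gaussian_inner(3,4)]
  have cov: "(\<integral>g. (axis i 1 \<bullet> g) * (axis j 1 \<bullet> g) \<partial>(std_gaussian :: (real^'k) measure)) = (if i = j then 1 else 0)" for i j :: 'k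
    unfolding pm(2) by (simp add: inner_add_left inner_add_right inner_axis_axis)
  show "integrable std_gaussian (\<lambda>g. \<Xi> \<bullet> outer g g)"
    unfolding eq by (intro Bochner_Integration.integrable_sum integrable_mult_right pm)
  have "(\<integral>g. \<Xi> \<bullet> outer g g \<partial>std_gaussian) =
      (\<Sum>i\<in>UNIV. \<Sum>j\<in>UNIV. \<Xi> $ i $ j * (\<integral>g. (axis i 1 \<bullet> g) * (axis j 1 \<bullet> g) \<partial>(std_gaussian :: (real^'k) measure)))"
    unfolding eq by (simp add: pm(1) Bochner_Integration.integral_sum)
  also have "\<dots> = \<Xi> \<bullet> mat 1"
    unfolding cov by (simp add: inner_vec_def mat_def)
  finally show "(\<integral>g. \<Xi> \<bullet> outer g g \<partial>std_gaussian) = \<Xi> \<bullet> mat 1" .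
qed

section \<open>Reward laws with finite second moments\<close>

locale reward_distribution = prob_space R for R :: "(real^'x) measure" +
  fixes \<Sigma> :: "real^'x^'x"
  assumes R_sets: "sets R = sets borel"
    and R_int: "\<And>i j. integrable R (\<lambda>r. r $ i * r $ j)"
    and R_cov: "\<And>i j. \<Sigma> $ i $ j = (\<integral>r. r $ i * r $ j \<partial>R)"
begin

declare R_sets [measurable_cong]

text \<open>The variance of \<open>\<Theta> \<bullet> Z\<close> under the limit law, and also of
  \<open>\<Theta> \<bullet> outer r g\<close> for one sample; the limit theorem rests on this
  agreement.\<close>

definition matrix_var :: "real^'k^'x \<Rightarrow> real" where
  "matrix_var \<Theta> = (\<Sum>k\<in>UNIV. column k \<Theta> \<bullet> (\<Sigma> *v column k \<Theta>))"

lemma second_moment: "integrable R (\<lambda>r. (u \<bullet> r)\<^sup>2)" "(\<integral>r. (u \<bullet> r)\<^sup>2 \<partial>R) = u \<bullet> (\<Sigma> *v u)"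
proof -
  have eq: "(u \<bullet> r)\<^sup>2 = (\<Sum>i\<in>UNIV. \<Sum>j\<in>UNIV. (u $ i * u $ j) * (r $ i * r $ j))" for r
    by (simp add: inner_vec_def power2_eq_square sum_product mult_ac)
  show "integrable R (\<lambda>r. (u \<bullet> r)\<^sup>2)"
    unfolding eq by (intro Bochner_Integration.integrable_sum integrable_mult_right R_int)
  show "(\<integral>r. (u \<bullet> r)\<^sup>2 \<partial>R) = u \<bullet> (\<Sigma> *v u)"
  proof -
    have "(\<integral>r. (\<Sum>i\<in>UNIV. \<Sum>j\<in>UNIV. (u $ i * u $ j) * (r $ i * r $ j)) \<partial>R) =
        (\<Sum>i\<in>UNIV. \<Sum>j\<in>UNIV. (u $ i * u $ j) * \<Sigma> $ i $ j)"
      unfolding R_cov by (simp add: R_int Bochner_Integration.integral_sum)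
    also have "\<dots> = u \<bullet> (\<Sigma> *v u)"
      by (simp add: inner_vec_def matrix_vector_mult_def sum_distrib_left mult_ac)
    finally show ?thesis unfolding eq .
  qed
qed

lemma matrix_var_nonneg: "0 \<le> matrix_var \<Theta>"
  unfolding matrix_var_def second_moment(2)[symmetric]
  by (intro sum_nonneg Bochner_Integration.integral_nonneg) simp

text \<open>Integrating over \<open>g\<close> first, with \<open>r\<close> fixed, leaves a centred
  Gaussian of variance equal to the sum of the
  \<open>(column k \<Theta> \<bullet> r)\<^sup>2\<close>; the second moments of \<open>R\<close>
  finish the computation.\<close>

lemma outer_moments:
  fixes \<Theta> :: "real^'k^'x"
  shows "integrable (R \<Otimes>\<^sub>M std_gaussian) (\<lambda>(r, g). (\<Theta> \<bullet> outer r g)\<^sup>2)"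
    "(\<integral>(r, g). (\<Theta> \<bullet> outer r g)\<^sup>2 \<partial>(R \<Otimes>\<^sub>M std_gaussian)) = matrix_var \<Theta>"
    "integrable (R \<Otimes>\<^sub>M std_gaussian) (\<lambda>(r, g). \<Theta> \<bullet> outer r g)"
    "(\<integral>(r, g). \<Theta> \<bullet> outer r g \<partial>(R \<Otimes>\<^sub>M std_gaussian)) = 0"
proof -
  interpret G: prob_space "std_gaussian :: (real^'k) measure"
    by (rule prob_space_std_gaussian)
  interpret P: pair_prob_space R "std_gaussian :: (real^'k) measure" ..
  have sq: "(transpose \<Theta> *v r) \<bullet> (transpose \<Theta> *v r) = (\<Sum>k\<in>UNIV. (column k \<Theta> \<bullet> r)\<^sup>2)" for r
    by (simp add: inner_vec_def matrix_vector_mult_def transpose_def column_def power2_eq_square)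
  have inner: "(\<integral>g. (\<Theta> \<bullet> outer r g)\<^sup>2 \<partial>std_gaussian) = (\<Sum>k\<in>UNIV. (column k \<Theta> \<bullet> r)\<^sup>2)" for r
    unfolding inner_outer std_gaussian_inner(4) sq ..
  show int: "integrable (R \<Otimes>\<^sub>M std_gaussian) (\<lambda>(r, g). (\<Theta> \<bullet> outer r g)\<^sup>2)"
  proof (rule P.Fubini_integrable)
    show "integrable R (\<lambda>r. \<integral>g. norm (case (r, g) of (r, g) \<Rightarrow> (\<Theta> \<bullet> outer r g)\<^sup>2) \<partial>std_gaussian)"
      by (simp add: inner second_moment)
    show "AE r in R. integrable std_gaussian (\<lambda>g. case (r, g) of (r, g) \<Rightarrow> (\<Theta> \<bullet> outer r g)\<^sup>2)"
      unfolding inner_outer by (simp add: std_gaussian_inner)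
  qed measurable
  show "(\<integral>(r, g). (\<Theta> \<bullet> outer r g)\<^sup>2 \<partial>(R \<Otimes>\<^sub>M std_gaussian)) = matrix_var \<Theta>"
    using P.integral_fst'[OF int]
    by (simp add: inner second_moment matrix_var_def)
  have "\<bar>x\<bar> \<le> 1 + x\<^sup>2" for x :: real
    using power2_diff[of "\<bar>x\<bar>" 1] zero_le_power2[of "\<bar>x\<bar> - 1"] by simp
  then show int1: "integrable (R \<Otimes>\<^sub>M std_gaussian) (\<lambda>(r, g). \<Theta> \<bullet> outer r g)"
    by (intro Bochner_Integration.integrable_bound[OF Bochner_Integration.integrable_add[OF P.integrable_const[of 1] int]])
       (auto simp: split_beta')
  show "(\<integral>(r, g). \<Theta> \<bullet> outer r g \<partial>(R \<Otimes>\<^sub>M std_gaussian)) = 0"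
    using P.integral_fst'[OF int1] by (simp add: inner_outer std_gaussian_inner)
qed

text \<open>The characteristic function at \<open>(\<Theta>, \<Xi>)\<close> of the contribution of
  one sample, with the weight written as g / sqrt M: the first pairing is linear in the weight, the
  second quadratic.\<close>

definition step_char :: "real^'k^'x \<Rightarrow> real^'k^'k \<Rightarrow> nat \<Rightarrow> complex" where
  "step_char \<Theta> \<Xi> M = (\<integral>(r, g). cis ((\<Theta> \<bullet> outer r g) / sqrt (real M) + (\<Xi> \<bullet> outer g g) / real M)
    \<partial>(R \<Otimes>\<^sub>M std_gaussian))"

lemma step_char_limit:
  fixes \<Theta> :: "real^'k^'x"
  shows "(\<lambda>M. of_nat M * (step_char \<Theta> \<Xi> M - 1)) \<longlonglongrightarrow>
    - of_real (matrix_var \<Theta>) / 2 + \<i> * of_real (\<Xi> \<bullet> mat 1)"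
proof -
  interpret G: prob_space "std_gaussian :: (real^'k) measure"
    by (rule prob_space_std_gaussian)
  interpret P: pair_prob_space R "std_gaussian :: (real^'k) measure" ..
  let ?\<mu> = "R \<Otimes>\<^sub>M (std_gaussian :: (real^'k) measure)"
  define a where "a = (\<lambda>(r, g). \<Theta> \<bullet> outer r g)"
  define b where "b = (\<lambda>(r :: real^'x, g). \<Xi> \<bullet> outer g g)"
  have [measurable]: "a \<in> borel_measurable ?\<mu>" "b \<in> borel_measurable ?\<mu>"
    unfolding a_def b_def by measurable
  have a: "integrable ?\<mu> (\<lambda>p. (a p)\<^sup>2)" "(\<integral>p. (a p)\<^sup>2 \<partial>?\<mu>) = matrix_var \<Theta>"
    "integrable ?\<mu> a" "integral\<^sup>L ?\<mu> a = 0"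
    using outer_moments[of \<Theta>] by (simp_all add: a_def split_beta')
  have b: "integrable ?\<mu> b"
    unfolding b_def by (rule integrable_pair_snd) (unfold_locales, rule std_gaussian_quadratic)
  have b': "integral\<^sup>L ?\<mu> b = \<Xi> \<bullet> mat 1"
    using P.integral_fst'[OF b] by (simp add: b_def std_gaussian_quadratic prob_space)
  let ?e = "\<lambda>M p. cis (a p / sqrt (real M) + b p / real M)"
  have step: "step_char \<Theta> \<Xi> M = (\<integral>p. ?e M p \<partial>?\<mu>)" for M
    by (simp add: step_char_def a_def b_def split_beta')
  have e_int: "integrable ?\<mu> (?e M)" for M
    by (rule integrable_cis[OF P.prob_space_axioms]) measurable
  let ?f = "\<lambda>M p. of_nat M * (?e M p - 1 - \<i> * of_real (a p / sqrt (real M)))"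
  \<comment> \<open>The subtracted linear term has integral 0, so inserting it changes nothing;
    without it the integrand would be of order sqrt M.\<close>
  have "of_nat M * (step_char \<Theta> \<Xi> M - 1) = integral\<^sup>L ?\<mu> (?f M)" for M
    using e_int[of M] a(3,4) by (simp add: step P.prob_space)
  moreover have "(\<lambda>M. integral\<^sup>L ?\<mu> (?f M)) \<longlonglongrightarrow> (\<integral>p. - (of_real (a p))\<^sup>2 / 2 + \<i> * of_real (b p) \<partial>?\<mu>)"
  proof (rule integral_dominated_convergence[where w="\<lambda>p. (a p)\<^sup>2 / 2 + \<bar>b p\<bar>"])
    show "AE p in ?\<mu>. (\<lambda>M. ?f M p) \<longlonglongrightarrow> - (of_real (a p))\<^sup>2 / 2 + \<i> * of_real (b p)"
      by (intro AE_I2 cis_scaled_limit)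
    show "AE p in ?\<mu>. norm (?f M p) \<le> (a p)\<^sup>2 / 2 + \<bar>b p\<bar>" for M
    proof (intro AE_I2)
      fix p
      have "norm (?f M p) \<le> real M * ((a p / sqrt (real M))\<^sup>2 / 2 + \<bar>b p / real M\<bar>)"
        unfolding norm_mult norm_of_nat by (intro mult_left_mono cis_expansion(1)) simp
      also have "\<dots> \<le> (a p)\<^sup>2 / 2 + \<bar>b p\<bar>"
        by (cases "M = 0") (auto simp: power_divide field_simps)
      finally show "norm (?f M p) \<le> (a p)\<^sup>2 / 2 + \<bar>b p\<bar>" .
    qed
  qed (use a b in auto)
  moreover have "(\<integral>p. - (complex_of_real (a p))\<^sup>2 / 2 + \<i> * of_real (b p) \<partial>?\<mu>) =
      - of_real (matrix_var \<Theta>) / 2 + \<i> * of_real (\<Xi> \<bullet> mat 1)"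
  proof -
    have "(\<integral>p. - (complex_of_real (a p))\<^sup>2 / 2 + \<i> * of_real (b p) \<partial>?\<mu>) =
        (\<integral>p. of_real (- (a p)\<^sup>2 / 2) + \<i> * of_real (b p) \<partial>?\<mu>)"
      by simp
    also have "\<dots> = of_real (\<integral>p. - (a p)\<^sup>2 / 2 \<partial>?\<mu>) + \<i> * of_real (\<integral>p. b p \<partial>?\<mu>)"
      using a(1) b by (subst Bochner_Integration.integral_add) (auto simp del: of_real_divide of_real_minus)
    finally show ?thesis
      using a(1,2) b' by simp
  qed
  ultimately show ?thesis by (simp only:)
qed

lemma step_char_power_limit:
  "(\<lambda>M. step_char \<Theta> \<Xi> M ^ M) \<longlonglongrightarrow> of_real (exp (- matrix_var \<Theta> / 2)) * cis (\<Xi> \<bullet> mat 1)"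
proof -
  interpret G: prob_space "std_gaussian :: (real^'a) measure"
    by (rule prob_space_std_gaussian)
  interpret P: pair_prob_space R "std_gaussian :: (real^'a) measure" ..
  have "cmod (step_char \<Theta> \<Xi> M) \<le> 1" for M
  proof -
    have "cmod (step_char \<Theta> \<Xi> M) \<le> (\<integral>p. cmod (case p of (r, g) \<Rightarrow>
        cis ((\<Theta> \<bullet> outer r g) / sqrt (real M) + (\<Xi> \<bullet> outer g g) / real M)) \<partial>(R \<Otimes>\<^sub>M std_gaussian))"
      unfolding step_char_def by (rule integral_norm_bound)
    then show ?thesis
      by (simp add: split_beta' P.prob_space)
  qed
  then have "(\<lambda>M. step_char \<Theta> \<Xi> M ^ M) \<longlonglongrightarrow> exp (- of_real (matrix_var \<Theta>) / 2 + \<i> * of_real (\<Xi> \<bullet> mat 1))"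
    by (rule power_limit_exp[OF _ step_char_limit]) (simp add: matrix_var_nonneg)
  moreover have "exp (- of_real (matrix_var \<Theta>) / 2 + \<i> * of_real (\<Xi> \<bullet> mat 1)) =
      complex_of_real (exp (- matrix_var \<Theta> / 2)) * cis (\<Xi> \<bullet> mat 1)"
    unfolding cis_conv_exp exp_of_real[symmetric] exp_add[symmetric] by simp
  ultimately show ?thesis by simp
qed

definition weighted_sums :: "nat \<Rightarrow> (nat \<Rightarrow> real^'x) \<times> (nat \<Rightarrow> real^'k) \<Rightarrow> (real^'k^'x) \<times> (real^'k^'k)" where
  "weighted_sums M = (\<lambda>(rs, ws). (\<Sum>m<M. outer (rs m) (ws m), \<Sum>m<M. outer (ws m) (ws m)))"

lemma sets_sample_law [measurable_cong]:
  "sets (sample_law R M) = sets (PiM {..<M} (\<lambda>_. borel) \<Otimes>\<^sub>M PiM {..<M} (\<lambda>_. borel))"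
  unfolding sample_law_def by (intro sets_pair_measure_cong sets_PiM_cong) (auto simp: R_sets)

lemma prob_space_sample_law: "prob_space (sample_law R M :: (_ \<times> (nat \<Rightarrow> real^'k)) measure)"
  unfolding sample_law_def
  \<comment> \<open>At \<open>M = 0\<close> the product has no factors; whenever a factor exists,
    \<open>M\<close> is positive and \<open>weight_law M\<close> is a probability measure.\<close>
  by (intro prob_space_pair prob_space_PiM prob_space_weight_law prob_space_axioms) auto

lemma measurable_weighted_sums [measurable]: "weighted_sums M \<in> borel_measurable (sample_law R M)"
  unfolding weighted_sums_def by measurable

text \<open>The exponential of the sums is a product over m whose m-th factor involves only the m-th
  reward and weight. These two are coupled inside a factor, but distinct factors are independent and
  alike.\<close>

lemma char_weighted_sums:
  fixes \<Theta> :: "real^'k^'x"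
  assumes M: "0 < M"
  shows "(\<integral>p. cis ((\<Theta>, \<Xi>) \<bullet> weighted_sums M p) \<partial>sample_law R M) = step_char \<Theta> \<Xi> M ^ M"
proof -
  interpret W: prob_space "weight_law M :: (real^'k) measure"
    by (rule prob_space_weight_law[OF M])
  interpret G: prob_space "std_gaussian :: (real^'k) measure"
    by (rule prob_space_std_gaussian)
  interpret P: pair_prob_space R "std_gaussian :: (real^'k) measure" ..
  interpret PR: product_prob_space "\<lambda>_::nat. R" by unfold_locales
  interpret PW: product_prob_space "\<lambda>_::nat. weight_law M :: (real^'k) measure" by unfold_locales
  interpret RM: prob_space "PiM {..<M} (\<lambda>_. R)"
    by (intro prob_space_PiM prob_space_axioms)
  interpret WM: prob_space "PiM {..<M} (\<lambda>_. weight_law M :: (real^'k) measure)"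
    by (intro prob_space_PiM W.prob_space_axioms)
  interpret PRW: pair_prob_space "PiM {..<M} (\<lambda>_. R)" "PiM {..<M} (\<lambda>_. weight_law M :: (real^'k) measure)" ..
  let ?k = "\<lambda>(r :: real^'x) (w :: real^'k). cis (\<Theta> \<bullet> outer r w + \<Xi> \<bullet> outer w w)"
  let ?K = "\<lambda>r. \<integral>w. ?k r w \<partial>weight_law M"
  have k: "cis ((\<Theta>, \<Xi>) \<bullet> weighted_sums M (rs, ws)) = (\<Prod>m<M. ?k (rs m) (ws m))" for rs ws
  proof -
    have "(\<Theta>, \<Xi>) \<bullet> weighted_sums M (rs, ws) = (\<Sum>m<M. \<Theta> \<bullet> outer (rs m) (ws m) + \<Xi> \<bullet> outer (ws m) (ws m))"
      by (simp add: weighted_sums_def inner_sum_right sum.distrib)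
    then show ?thesis
      by (simp add: cis_conv_exp sum_distrib_left exp_sum)
  qed
  have K_int: "integrable R ?K"
  proof (rule integrable_const_bound[where B=1])
    show "?K \<in> borel_measurable R" by measurable
    have "norm (?K r) \<le> (\<integral>w. norm (?k r w) \<partial>weight_law M)" for r
      by (rule integral_norm_bound)
    then show "AE r in R. norm (?K r) \<le> 1"
      by (simp add: W.prob_space)
  qed
  have "integrable (sample_law R M) (\<lambda>p. cis ((\<Theta>, \<Xi>) \<bullet> weighted_sums M p))"
    by (rule integrable_cis[OF prob_space_sample_law]) measurable
  then have "(\<integral>p. cis ((\<Theta>, \<Xi>) \<bullet> weighted_sums M p) \<partial>sample_law R M) =
      (\<integral>rs. \<integral>ws. cis ((\<Theta>, \<Xi>) \<bullet> weighted_sums M (rs, ws)) \<partial>PiM {..<M} (\<lambda>_. weight_law M) \<partial>PiM {..<M} (\<lambda>_. R))"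
    unfolding sample_law_def by (rule PRW.integral_fst'[symmetric])
  \<comment> \<open>With the rewards frozen, each factor depends on a single weight vector, so the
    inner integral splits although the factors differ with m.\<close>
  also have "\<dots> = (\<integral>rs. (\<Prod>m<M. ?K (rs m)) \<partial>PiM {..<M} (\<lambda>_. R))"
    unfolding k
    by (intro Bochner_Integration.integral_cong refl PW.product_integral_prod integrable_cis W.prob_space_axioms)
       auto
  also have "\<dots> = (\<Prod>m<M. \<integral>r. ?K r \<partial>R)"
    by (intro PR.product_integral_prod K_int) auto
  also have "(\<integral>r. ?K r \<partial>R) = step_char \<Theta> \<Xi> M"
  proof -
    have "?K r = (\<integral>g. cis ((\<Theta> \<bullet> outer r g) / sqrt (real M) + (\<Xi> \<bullet> outer g g) / real M) \<partial>std_gaussian)" for r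
    proof -
      have "outer u ((1 / sqrt (real M)) *\<^sub>R g) = (1 / sqrt (real M)) *\<^sub>R outer u g"
        "outer ((1 / sqrt (real M)) *\<^sub>R g) v = (1 / sqrt (real M)) *\<^sub>R outer g v"
        for u :: "real^'x" and g v :: "real^'k"
        by (simp_all add: outer_def vec_eq_iff)
      moreover have "outer g ((1 / sqrt (real M)) *\<^sub>R v) = (1 / sqrt (real M)) *\<^sub>R outer g v"
        for g v :: "real^'k"
        by (simp add: outer_def vec_eq_iff)
      ultimately show ?thesis
        unfolding weight_law_eq[OF M] by (subst integral_distr) simp_all
    qed
    moreover have "integrable (R \<Otimes>\<^sub>M std_gaussian)
        (\<lambda>(r, g). cis ((\<Theta> \<bullet> outer r g) / sqrt (real M) + (\<Xi> \<bullet> outer g g) / real M))"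
      unfolding split_beta' by (rule integrable_cis[OF P.prob_space_axioms]) measurable
    ultimately show ?thesis
      unfolding step_char_def by (simp add: P.integral_fst'[symmetric])
  qed
  finally show ?thesis by simp
qed

lemma weighted_sums_conv_distr:
  fixes Q :: "(real^'k^'x) measure"
  assumes Q: "gaussian_matrix_law \<Sigma> Q"
  shows "conv_distr (\<lambda>M. distr (sample_law R M) borel (weighted_sums M))
    (distr Q borel (\<lambda>Z. (Z, mat 1 :: real^'k^'k))) sequentially"
proof (rule levy_continuity_euclidean)
  interpret Q: prob_space Q using Q by (simp add: gaussian_matrix_law_def)
  have [measurable_cong]: "sets Q = sets borel" using Q by (simp add: gaussian_matrix_law_def)
  show "prob_space (distr (sample_law R M) borel (weighted_sums M))" for M
    by (intro prob_space.prob_space_distr prob_space_sample_law) measurable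
  show "prob_space (distr Q borel (\<lambda>Z. (Z, mat 1 :: real^'k^'k)))"
    by (intro Q.prob_space_distr) measurable
  fix \<theta> :: "(real^'k^'x) \<times> (real^'k^'k)"
  obtain \<Theta> \<Xi> where \<theta>: "\<theta> = (\<Theta>, \<Xi>)" by force
  have "(\<lambda>M. \<integral>x. cis (\<theta> \<bullet> x) \<partial>distr (sample_law R M) borel (weighted_sums M))
      \<longlonglongrightarrow> of_real (exp (- matrix_var \<Theta> / 2)) * cis (\<Xi> \<bullet> mat 1)"
  proof (rule Lim_transform_eventually[OF step_char_power_limit])
    show "\<forall>\<^sub>F M in sequentially. step_char \<Theta> \<Xi> M ^ M =
        (\<integral>x. cis (\<theta> \<bullet> x) \<partial>distr (sample_law R M) borel (weighted_sums M))"
      using eventually_gt_at_top[of 0]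
      by eventually_elim (simp add: integral_distr char_weighted_sums \<theta>)
  qed
  \<comment> \<open>The factor \<open>cis (\<Xi> \<bullet> mat 1)\<close> is the characteristic
    function of a constant: the second coordinate of the limit is deterministic.\<close>
  also have "of_real (exp (- matrix_var \<Theta> / 2)) * cis (\<Xi> \<bullet> mat 1) =
      (\<integral>x. cis (\<theta> \<bullet> x) \<partial>distr Q borel (\<lambda>Z. (Z, mat 1 :: real^'k^'k)))"
    using Q by (simp add: integral_distr \<theta> gaussian_matrix_law_def matrix_var_def flip: cis_mult)
  finally show "(\<lambda>M. \<integral>x. cis (\<theta> \<bullet> x) \<partial>distr (sample_law R M) borel (weighted_sums M))
      \<longlonglongrightarrow> (\<integral>x. cis (\<theta> \<bullet> x) \<partial>distr Q borel (\<lambda>Z. (Z, mat 1 :: real^'k^'k)))" .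
qed simp_all

end

section \<open>Convergence of the representation\<close>

lemma conv_distr_continuous_image:
  fixes h :: "'a::topological_space \<Rightarrow> 'b::topological_space"
  assumes L: "conv_distr L Q F" and h: "continuous_on UNIV h"
    and sets: "\<And>i. sets (L i) = sets borel" "sets Q = sets borel"
  shows "conv_distr (\<lambda>i. distr (L i) borel h) (distr Q borel h) F"
  unfolding conv_distr_def
proof (intro allI impI)
  fix f :: "'b \<Rightarrow> real"
  assume f: "continuous_on UNIV f" "bounded (range f)"
  have [measurable]: "h \<in> borel_measurable borel" "f \<in> borel_measurable borel"
    using h f(1) by (auto intro!: borel_measurable_continuous_onI)
  have meas: "h \<in> M \<rightarrow>\<^sub>M borel" if "sets M = sets borel" for M
    using that by (subst measurable_cong_sets[OF _ refl]) auto
  have "bounded (range (\<lambda>x. f (h x)))"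
    by (rule bounded_subset[OF f(2)]) auto
  with continuous_on_compose2[OF f(1) h] have "((\<lambda>i. \<integral>x. f (h x) \<partial>L i) \<longlongrightarrow> (\<integral>x. f (h x) \<partial>Q)) F"
    using L unfolding conv_distr_def by blast
  then show "((\<lambda>i. integral\<^sup>L (distr (L i) borel h) f) \<longlongrightarrow> integral\<^sup>L (distr Q borel h) f) F"
    by (simp add: integral_distr meas sets)
qed

text \<open>All the laws are images of the single measure \<open>Q\<close>, so pointwise convergence
  of the maps and bounded convergence suffice.\<close>

lemma conv_distr_AE_at_top:
  fixes X :: "real \<Rightarrow> 'a \<Rightarrow> 'b::metric_space"
  assumes Q: "prob_space Q" and X [measurable]: "\<And>t. X t \<in> Q \<rightarrow>\<^sub>M borel" and Y [measurable]: "Y \<in> Q \<rightarrow>\<^sub>M borel"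
    and lim: "\<And>z. z \<in> space Q \<Longrightarrow> ((\<lambda>t. X t z) \<longlongrightarrow> Y z) at_top"
  shows "conv_distr (\<lambda>t. distr Q borel (X t)) (distr Q borel Y) at_top"
  unfolding conv_distr_def
proof (intro allI impI)
  interpret prob_space Q by fact
  fix f :: "'b \<Rightarrow> real"
  assume f: "continuous_on UNIV f" "bounded (range f)"
  then have [measurable]: "f \<in> borel_measurable borel"
    by (auto intro!: borel_measurable_continuous_onI)
  obtain B where B: "\<And>x. \<bar>f x\<bar> \<le> B"
    using f(2) by (auto simp: bounded_iff)
  have "((\<lambda>t. \<integral>z. f (X t z) \<partial>Q) \<longlongrightarrow> (\<integral>z. f (Y z) \<partial>Q)) at_top"
  proof (rule integral_dominated_convergence_at_top[where w="\<lambda>_. B"])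
    show "AE z in Q. ((\<lambda>t. f (X t z)) \<longlongrightarrow> f (Y z)) at_top"
      using lim f(1) by (auto intro!: AE_I2 continuous_on_tendsto_compose[OF f(1)])
  qed (auto simp: B)
  then show "((\<lambda>t. integral\<^sup>L (distr Q borel (X t)) f) \<longlongrightarrow> integral\<^sup>L (distr Q borel Y) f) at_top"
    by (simp add: integral_distr)
qed

context reward_distribution
begin

text \<open>Along the line through \<open>\<Theta>\<close> the exponent scales as the square of the
  parameter, so \<open>\<Theta> \<bullet> Z\<close> is a centred normal with variance
  \<open>matrix_var \<Theta>\<close>.\<close>

lemma gaussian_matrix_moments:
  fixes Q :: "(real^'k^'x) measure"
  assumes Q: "gaussian_matrix_law \<Sigma> Q"
  shows "(\<integral>Z. \<Theta> \<bullet> Z \<partial>Q) = 0" "integrable Q (\<lambda>Z. (\<Theta> \<bullet> Z)\<^sup>2)" "(\<integral>Z. (\<Theta> \<bullet> Z)\<^sup>2 \<partial>Q) = matrix_var \<Theta>"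
proof -
  have Q': "prob_space Q" "sets Q = sets borel"
    and char: "\<And>\<Theta>. (\<integral>z. cis (\<Theta> \<bullet> z) \<partial>Q) = complex_of_real (exp (- matrix_var \<Theta> / 2))"
    using Q by (auto simp: gaussian_matrix_law_def matrix_var_def)
  have "matrix_var (s *\<^sub>R \<Theta>) = s\<^sup>2 * matrix_var \<Theta>" for s
  proof -
    have "column k (s *\<^sub>R \<Theta>) = s *\<^sub>R column k \<Theta>" for k
      by (simp add: column_def vec_eq_iff)
    then show ?thesis
      by (simp add: matrix_var_def sum_distrib_left power2_eq_square mult.assoc
          linear_cmul[OF matrix_vector_mul_linear])
  qed
  then have "(\<integral>z. cis (s * (\<Theta> \<bullet> z)) \<partial>Q) = complex_of_real (exp (- (s\<^sup>2 * matrix_var \<Theta>) / 2))" for s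
    using char[of "s *\<^sub>R \<Theta>"] by simp
  from gaussian_char_moments[OF Q' this matrix_var_nonneg]
  show "(\<integral>Z. \<Theta> \<bullet> Z \<partial>Q) = 0" "integrable Q (\<lambda>Z. (\<Theta> \<bullet> Z)\<^sup>2)" "(\<integral>Z. (\<Theta> \<bullet> Z)\<^sup>2 \<partial>Q) = matrix_var \<Theta>"
    by blast+
qed

text \<open>Entries of a column of \<open>\<Psi> ** Z\<close> are inner products of \<open>Z\<close>
  with fixed matrices, so their covariances follow by polarizing \<open>matrix_var\<close>.\<close>

lemma gaussian_matrix_column_cov:
  fixes Q :: "(real^'k^'x) measure" and \<Psi> :: "real^'x^'x"
  assumes Q: "gaussian_matrix_law \<Sigma> Q"
  shows "cov_entry (distr Q borel (\<lambda>Z. column k (\<Psi> ** Z))) i j = (\<Psi> ** \<Sigma> ** transpose \<Psi>) $ i $ j"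
proof -
  have Q_sets [measurable_cong]: "sets Q = sets borel" using Q by (simp add: gaussian_matrix_law_def)
  \<comment> \<open>\<open>e u\<close> has \<open>u\<close> as its column \<open>k\<close> and zeros
    elsewhere; pairing with \<open>e (\<Psi> $ i)\<close> reads off entry \<open>i\<close> of column
    \<open>k\<close>.\<close>
  define e where "e u = (\<chi> x l. if l = k then u $ x else (0 :: real))" for u :: "real^'x"
  have col: "column l (e u) = (if l = k then u else 0)" for l u
    by (simp add: e_def column_def vec_eq_iff)
  have e: "column k (\<Psi> ** Z) $ i = e (\<Psi> $ i) \<bullet> Z" for i Z
    by (simp add: e_def column_def matrix_matrix_mult_def inner_vec_def if_distrib if_distribR cong: if_cong)
  have e_add: "e u + e v = e (u + v)" for u v
    by (simp add: e_def vec_eq_iff)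
  have var: "matrix_var (e u) = u \<bullet> (\<Sigma> *v u)" for u
    by (simp add: matrix_var_def col if_distrib if_distribR cong: if_cong)
  \<comment> \<open>Symmetry makes the two cross terms of the polarized form equal, which absorbs
    the factor 1/2.\<close>
  have sym: "transpose \<Sigma> = \<Sigma>"
    by (simp add: transpose_def vec_eq_iff R_cov mult.commute)
  have meas [measurable]: "(\<lambda>Z. column k (\<Psi> ** Z)) \<in> borel_measurable Q"
  proof -
    have "continuous_on UNIV (\<lambda>Z :: real^'k^'x. column k (\<Psi> ** Z))"
      unfolding column_def
      by (intro continuous_intros bounded_bilinear.continuous_on[OF bounded_bilinear_matrix_mult])
    then show ?thesis
      unfolding measurable_cong_sets[OF Q_sets refl] by (rule borel_measurable_continuous_onI)
  qed
  have mean: "(\<integral>u. u $ i \<partial>distr Q borel (\<lambda>Z. column k (\<Psi> ** Z))) = 0" for i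
    by (subst integral_distr) (auto simp: e gaussian_matrix_moments(1)[OF Q])
  have "cov_entry (distr Q borel (\<lambda>Z. column k (\<Psi> ** Z))) i j =
      (\<integral>Z. (e (\<Psi> $ i) \<bullet> Z) * (e (\<Psi> $ j) \<bullet> Z) \<partial>Q)"
    unfolding cov_entry_def mean by (subst integral_distr) (auto simp: e)
  also have "\<dots> = ((\<Psi> $ i + \<Psi> $ j) \<bullet> (\<Sigma> *v (\<Psi> $ i + \<Psi> $ j)) - \<Psi> $ i \<bullet> (\<Sigma> *v \<Psi> $ i) - \<Psi> $ j \<bullet> (\<Sigma> *v \<Psi> $ j)) / 2"
    by (subst polarized_moments(2)[OF gaussian_matrix_moments(2,3)[OF Q]]) (simp add: e_add var)
  also have "\<dots> = \<Psi> $ i \<bullet> (\<Sigma> *v \<Psi> $ j)"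
  proof -
    have "\<Psi> $ j \<bullet> (\<Sigma> *v \<Psi> $ i) = \<Psi> $ i \<bullet> (\<Sigma> *v \<Psi> $ j)"
      by (metis dot_lmul_matrix inner_commute sym vector_transpose_matrix)
    then show ?thesis
      by (simp add: matrix_vector_right_distrib inner_add_left inner_add_right)
  qed
  also have "\<dots> = (\<Psi> ** \<Sigma> ** transpose \<Psi>) $ i $ j"
    unfolding matrix_mul_assoc[symmetric]
    by (simp add: matrix_matrix_mult_def matrix_vector_mult_def inner_vec_def transpose_def)
  finally show ?thesis .
qed

end

text \<open>The iterated limit is expressed in two stages: M first, at each fixed t, then t in the
  resulting laws. \<open>Phi\<close> is any family that solves the equation for every sample, and
  \<open>Q\<close> any law with the prescribed characteristic function.\<close>

theorem theorem5p9:
  fixes P :: "real^'x^'x" and \<gamma> :: real and \<Phi>0 :: "real^'k^'x"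
    and R :: "(real^'x) measure" and \<Sigma> :: "real^'x^'x"
    and Phi :: "nat \<Rightarrow> real \<Rightarrow> (nat \<Rightarrow> real^'x) \<Rightarrow> (nat \<Rightarrow> real^'k) \<Rightarrow> real^'k^'x"
    and Q :: "(real^'k^'x) measure"
  assumes P: "row_stochastic P"
    and \<gamma>: "0 \<le> \<gamma>" "\<gamma> < 1"
    and R_prob: "prob_space R" and R_sets: "sets R = sets borel"
    and R_int: "\<And>i j. integrable R (\<lambda>r. r $ i * r $ j)"
    and R_mean: "\<And>i. integrable R (\<lambda>r. r $ i) \<and> (\<integral>r. r $ i \<partial>R) = 0"
    and R_cov: "\<And>i j. \<Sigma> $ i $ j = (\<integral>r. r $ i * r $ j \<partial>R)"
    and Phi_init: "\<And>M rs ws. Phi M 0 rs ws = \<Phi>0"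
    and Phi_ode: "\<And>M rs ws t. 0 \<le> t \<Longrightarrow>
        ((\<lambda>s. Phi M s rs ws) has_vector_derivative
          (\<Sum>m<M. outer (rs m + \<gamma> *\<^sub>R (P *v (Phi M t rs ws *v ws m)) - Phi M t rs ws *v ws m) (ws m)))
        (at t within {0..})"
    and Q: "gaussian_matrix_law \<Sigma> Q"
  shows
    "conv_distr (\<lambda>M. distr (sample_law R M) borel (\<lambda>(rs, ws). \<Sum>m<M. outer (rs m) (ws m)))
        Q sequentially
     \<and> (\<forall>t\<ge>0. conv_distr (\<lambda>M. distr (sample_law R M) borel (\<lambda>(rs, ws). Phi M t rs ws))
          (distr Q borel (\<lambda>Z. mexp (- t *\<^sub>R (mat 1 - \<gamma> *\<^sub>R P))
                 ** (\<Phi>0 - matrix_inv (mat 1 - \<gamma> *\<^sub>R P) ** Z)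
               + matrix_inv (mat 1 - \<gamma> *\<^sub>R P) ** Z)) sequentially)
     \<and> conv_distr (\<lambda>t. distr Q borel (\<lambda>Z. mexp (- t *\<^sub>R (mat 1 - \<gamma> *\<^sub>R P))
                 ** (\<Phi>0 - matrix_inv (mat 1 - \<gamma> *\<^sub>R P) ** Z)
               + matrix_inv (mat 1 - \<gamma> *\<^sub>R P) ** Z))
          (distr Q borel (\<lambda>Z. matrix_inv (mat 1 - \<gamma> *\<^sub>R P) ** Z)) at_top
     \<and> (\<forall>k i j. cov_entry (distr Q borel (\<lambda>Z. column k (matrix_inv (mat 1 - \<gamma> *\<^sub>R P) ** Z))) i j
          = (matrix_inv (mat 1 - \<gamma> *\<^sub>R P) ** \<Sigma> ** transpose (matrix_inv (mat 1 - \<gamma> *\<^sub>R P))) $ i $ j)"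
proof -
  interpret reward_distribution R \<Sigma>
    by (intro reward_distribution.intro reward_distribution_axioms.intro R_prob R_sets R_int R_cov)
  let ?A = "mat 1 - \<gamma> *\<^sub>R P"
  let ?\<Psi> = "matrix_inv ?A"
  let ?F = "\<lambda>t Z. mexp (- t *\<^sub>R ?A) ** (\<Phi>0 - ?\<Psi> ** Z) + ?\<Psi> ** Z"
  let ?J = "\<lambda>M. distr (sample_law R M) borel (weighted_sums M :: _ \<Rightarrow> (real^'k^'x) \<times> (real^'k^'k))"
  let ?QJ = "distr Q borel (\<lambda>Z. (Z, mat 1 :: real^'k^'k))"
  have Q_prob: "prob_space Q" and Q_sets [measurable_cong]: "sets Q = sets borel"
    using Q by (simp_all add: gaussian_matrix_law_def)
  have joint: "conv_distr ?J ?QJ sequentially"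
    by (rule weighted_sums_conv_distr[OF Q])
  \<comment> \<open>One joint limit yields both of the first two claims, with \<open>h\<close> taken
    as \<open>fst\<close> and as the flow at time t.\<close>
  have image: "conv_distr (\<lambda>M. distr (sample_law R M) borel (\<lambda>p. h (weighted_sums M p)))
      (distr Q borel (\<lambda>Z. h (Z, mat 1))) sequentially"
    if h: "continuous_on UNIV h" for h :: "(real^'k^'x) \<times> (real^'k^'k) \<Rightarrow> real^'k^'x"
  proof -
    have [measurable]: "h \<in> borel_measurable borel"
      using h by (rule borel_measurable_continuous_onI)
    have "conv_distr (\<lambda>M. distr (?J M) borel h) (distr ?QJ borel h) sequentially"
      by (rule conv_distr_continuous_image[OF joint h]) auto
    then show ?thesis
      by (simp add: distr_distr o_def)
  qed
  have "conv_distr (\<lambda>M. distr (sample_law R M) borel (\<lambda>(rs, ws). \<Sum>m<M. outer (rs m) (ws m))) Q sequentially"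
  proof -
    have "distr Q borel (\<lambda>Z. fst (Z, mat 1 :: real^'k^'k)) = Q"
      using Q_sets by (simp add: distr_id2)
    then show ?thesis
      using image[of fst] by (simp add: weighted_sums_def split_beta' continuous_intros)
  qed
  moreover have "conv_distr (\<lambda>M. distr (sample_law R M) borel (\<lambda>(rs, ws). Phi M t rs ws))
      (distr Q borel (?F t)) sequentially" if t: "0 \<le> t" for t
  proof -
    \<comment> \<open>The identity holds for every sample, so the law of \<open>Phi\<close> is the
      image of the sums under a continuous map, and its measurability in the sample follows.\<close>
    have "Phi M t rs ws = td_flow ?A t \<Phi>0 (weighted_sums M (rs, ws))" for M rs ws
      using td_flow_unique[where \<Phi>="\<lambda>s. Phi M s rs ws", OF _ t] Phi_ode
      by (simp add: td_sum_eq weighted_sums_def Phi_init)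
    moreover have "td_flow ?A t \<Phi>0 (Z, mat 1) = ?F t Z" for Z
      by (rule td_flow_identity[OF matrix_inv_discounted[OF P \<gamma>] t])
    ultimately show ?thesis
      using image[OF continuous_on_td_flow[of ?A t \<Phi>0]] by (simp add: split_beta')
  qed
  moreover have "conv_distr (\<lambda>t. distr Q borel (?F t)) (distr Q borel (\<lambda>Z. ?\<Psi> ** Z)) at_top"
  proof (rule conv_distr_AE_at_top[OF Q_prob])
    have cont: "continuous_on UNIV (?F t)" "continuous_on UNIV (\<lambda>Z :: real^'k^'x. ?\<Psi> ** Z)" for t
      by (intro continuous_intros bounded_bilinear.continuous_on[OF bounded_bilinear_matrix_mult])+
    show "?F t \<in> Q \<rightarrow>\<^sub>M borel" "(\<lambda>Z. ?\<Psi> ** Z) \<in> Q \<rightarrow>\<^sub>M borel" for t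
      using cont[THEN borel_measurable_continuous_onI] by (simp_all add: measurable_cong_sets[OF Q_sets refl])
    fix Z
    \<comment> \<open>Only the transient carries the matrix exponential; the stationary part is
      constant in t.\<close>
    have "((\<lambda>t. ?F t Z) \<longlongrightarrow> 0 ** (\<Phi>0 - ?\<Psi> ** Z) + ?\<Psi> ** Z) at_top"
      by (intro tendsto_intros bounded_bilinear.tendsto[OF bounded_bilinear_matrix_mult] mexp_tendsto_0 P \<gamma>)
    then show "((\<lambda>t. ?F t Z) \<longlongrightarrow> ?\<Psi> ** Z) at_top"
      by (simp add: matrix_mult_bilinear_simps)
  qed
  ultimately show ?thesis
    using gaussian_matrix_column_cov[OF Q] by blast
qed

end
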